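(* Let $X$ be a Banach space. Suppose that the linear equation $v'=A(t)v$ admits a generalized trichotomy with bounds $\alpha_{t,s}$, $\beta^+_{t,s}$ and $\beta^-_{t,s}$, and let $f\colon\mathbb{R}\times X\to X$ be a continuous function such that $f(t,0)=0$ and $\operatorname{Lip}(f_t)<+\infty$ for every $t\in\mathbb{R}$. Let $$\sigma:=\sup_{(t,s)\in\mathbb{R}^2}\left|\int_s^t\frac{\alpha_{t,r}\operatorname{Lip}(f_r)\,\alpha_{r,s}}{\alpha_{t,s}}\,dr\right|,\qquad \omega:=\sup_{s\in\mathbb{R}}\left[\int_{-\infty}^s\beta^+_{s,r}\operatorname{Lip}(f_r)\,\alpha_{r,s}\,dr+\int_s^{+\infty}\beta^-_{s,r}\operatorname{Lip}(f_r)\,\alpha_{r,s}\,dr\right],$$ which are supposed to be finite. If $$\lim_{r\to+\infty}\beta^-_{s,r}\alpha_{r,s}=\lim_{r\to-\infty}\beta^+_{s,r}\alpha_{r,s}=0\quad\text{for every } s\in\mathbb{R}$$ and $$2\sigma+2\omega<1,$$ then there is $N\in(0,1)$ and a unique $\varphi\in\mathcal{A}_N$ such that $$\Psi_\tau(\mathcal{V}_\varphi)\subseteq\mathcal{V}_\varphi\quad\text{for every }\tau\in\mathbb{R}.$$ Moreover, $$\left\|\Psi_{t-s}(s,\xi,\varphi(s,\xi))-\Psi_{t-s}(s,\bar\xi,\varphi(s,\bar\xi))\right\|\le\frac{N}{\omega}\,\alpha_{t,s}\,\|\xi-\bar\xi\|$$ for all $t\in\mathbb{R}$ and all $(s,\xi),(s,\bar\xi)\in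 G$.
   Context: $X$ is a Banach space, $B(X)$ the Banach algebra of bounded linear operators on $X$, and $A\colon\mathbb{R}\to B(X)$ is continuous. $T_{t,s}$ ($t,s\in\mathbb{R}$) is the evolution operator of $v'=A(t)v$ (whose solutions are assumed global): every solution satisfies $v(t)=T_{t,s}v(s)$. Invariant splitting: for every $t\in\mathbb{R}$ there are bounded projections $P_t,Q^+_t,Q^-_t\in B(X)$ such that, for all $t,s\in\mathbb{R}$: $P_t+Q^+_t+Q^-_t=\mathrm{Id}$; $P_tQ^+_t=0$; $P_tT_{t,s}=T_{t,s}P_s$; $Q^+_tT_{t,s}=T_{t,s}Q^+_s$. Put $E_t=P_t(X)$, $F^+_t=Q^+_t(X)$, $F^-_t=Q^-_t(X)$; $E_t\times F^+_t\times F^-_t$ is identified with $E_t\oplus F^+_t\oplus F^-_t=X$. Generalized trichotomy: let $\mathbb{R}^2_{\ge}=\{(t,s)\in\mathbb{R}^2: t\ge s\}$, $\mathbb{R}^2_{\le}=\{(t,s)\in\mathbb{R}^2: t\le s\}$. Given functions $\alpha\colon\mathbb{R}^2\to\mathbb{R}^+$, $\beta^+\colon\mathbb{R}^2_\ge\to\mathbb{R}^+$, $\beta^-\colon\mathbb{R}^2_\le\to\mathbb{R}^+$ (positive values, written $\alpha_{t,s}$, $\beta^+_{t,s}$, $\beta^-_{t,s}$), the equation $v'=A(t)v$ admits a generalized trichotomy with these bounds if it admits an invariant splitting such that $\|T_{t,s}P_s\|\le\alpha_{t,s}$ for all $(t,s)\in\mathbb{R}^2$, $\|T_{t,s}Q^+_s\|\le\beta^+_{t,s}$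 for all $(t,s)\in\mathbb{R}^2_\ge$, and $\|T_{t,s}Q^-_s\|\le\beta^-_{t,s}$ for all $(t,s)\in\mathbb{R}^2_\le$. For $f\colon\mathbb{R}\times X\to X$, $f_t(x)=f(t,x)$ and $\operatorname{Lip}(f_t)=\sup\{\|f(t,x)-f(t,y)\|/\|x-y\|: x,y\in X,\ x\ne y\}$. Flow: for $s\in\mathbb{R}$ and $v_s=(\xi,\eta^+,\eta^-)\in E_s\times F^+_s\times F^-_s$, let $(x(t,s,v_s),y^+(t,s,v_s),y^-(t,s,v_s))\in E_t\times F^+_t\times F^-_t$, $t\in\mathbb{R}$, be the only solution of $v'=A(t)v+f(t,v)$, $v(s)=v_s$. For $\tau\in\mathbb{R}$, $\Psi_\tau(s,v_s)=(s+\tau,x(s+\tau,s,v_s),y^+(s+\tau,s,v_s),y^-(s+\tau,s,v_s))\in\mathbb{R}\times X$. A difference of two points of $\mathbb{R}\times X$ with the same first coordinate is measured by the norm of $X$ of its second component. $G=\bigcup_{t\in\mathbb{R}}\{t\}\times E_t$. For $N>0$, $\mathcal{A}_N$ is the set of all continuous $\varphi\colon G\to X$ such that $\varphi(t,0)=0$ for all $t\in\mathbb{R}$; $\varphi(t,\xi)\in F^+_t\oplus F^-_t$ for all $(t,\xi)\in G$; and $\|\varphi(t,\xi)-\varphi(t,\bar\xi)\|\le N\|\xi-\bar\xi\|$ for all $(t,\xi),(t,\bar\xi)\in G$. The graph of $\varphi$ is $\mathcal{V}_\varphi=\{(s,\xi,\varphi(s,\xi)):(s,\xi)\in G\}\subseteq\mathbb{R}\times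 X$. *)

theory Defs
  imports "HOL-Analysis.Analysis"
begin

section \<open>The linear equation and its evolution operator\<close>

definition linear_solution :: "(real \<Rightarrow> 'a::banach \<Rightarrow>\<^sub>L 'a) \<Rightarrow> (real \<Rightarrow> 'a) \<Rightarrow> bool" where
  "linear_solution A v \<longleftrightarrow> (\<forall>t. (v has_vector_derivative A t (v t)) (at t))"

definition evolution_operator ::
    "(real \<Rightarrow> 'a::banach \<Rightarrow>\<^sub>L 'a) \<Rightarrow> (real \<Rightarrow> real \<Rightarrow> 'a \<Rightarrow>\<^sub>L 'a) \<Rightarrow> bool" where
  "evolution_operator A T \<longleftrightarrow>
     (\<forall>s x. linear_solution A (\<lambda>t. T t s x) \<and> T s s x = x) \<and>
     (\<forall>v. linear_solution A v \<longrightarrow> (\<forall>t s. v t = T t s (v s)))"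

section \<open>Invariant splittings and generalized trichotomies\<close>

definition projection :: "('a::real_normed_vector \<Rightarrow>\<^sub>L 'a) \<Rightarrow> bool" where
  "projection P \<longleftrightarrow> P o\<^sub>L P = P"

definition invariant_splitting ::
    "(real \<Rightarrow> real \<Rightarrow> 'a::banach \<Rightarrow>\<^sub>L 'a) \<Rightarrow> (real \<Rightarrow> 'a \<Rightarrow>\<^sub>L 'a) \<Rightarrow>
     (real \<Rightarrow> 'a \<Rightarrow>\<^sub>L 'a) \<Rightarrow> (real \<Rightarrow> 'a \<Rightarrow>\<^sub>L 'a) \<Rightarrow> bool" where
  "invariant_splitting T P Qp Qm \<longleftrightarrow>
     (\<forall>t. projection (P t) \<and> projection (Qp t) \<and> projection (Qm t)) \<and>
     (\<forall>t. P t + Qp t + Qm t = id_blinfun) \<and>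
     (\<forall>t. P t o\<^sub>L Qp t = 0) \<and>
     (\<forall>t s. P t o\<^sub>L T t s = T t s o\<^sub>L P s) \<and>
     (\<forall>t s. Qp t o\<^sub>L T t s = T t s o\<^sub>L Qp s)"

text \<open>The bounds are total functions; the values of \<open>\<beta>p t s\<close> for \<open>t < s\<close> and of
  \<open>\<beta>m t s\<close> for \<open>t > s\<close> are unconstrained and are never used.\<close>

definition generalized_trichotomy ::
    "(real \<Rightarrow> real \<Rightarrow> 'a::banach \<Rightarrow>\<^sub>L 'a) \<Rightarrow> (real \<Rightarrow> 'a \<Rightarrow>\<^sub>L 'a) \<Rightarrow>
     (real \<Rightarrow> 'a \<Rightarrow>\<^sub>L 'a) \<Rightarrow> (real \<Rightarrow> 'a \<Rightarrow>\<^sub>L 'a) \<Rightarrow> (real \<Rightarrow> real \<Rightarrow> real) \<Rightarrow>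
     (real \<Rightarrow> real \<Rightarrow> real) \<Rightarrow> (real \<Rightarrow> real \<Rightarrow> real) \<Rightarrow> bool" where
  "generalized_trichotomy T P Qp Qm \<alpha> \<beta>p \<beta>m \<longleftrightarrow>
     invariant_splitting T P Qp Qm \<and>
     (\<forall>t s. 0 < \<alpha> t s) \<and> (\<forall>t s. t \<ge> s \<longrightarrow> 0 < \<beta>p t s) \<and> (\<forall>t s. t \<le> s \<longrightarrow> 0 < \<beta>m t s) \<and>
     (\<forall>t s. norm (T t s o\<^sub>L P s) \<le> \<alpha> t s) \<and>
     (\<forall>t s. t \<ge> s \<longrightarrow> norm (T t s o\<^sub>L Qp s) \<le> \<beta>p t s) \<and>
     (\<forall>t s. t \<le> s \<longrightarrow> norm (T t s o\<^sub>L Qm s) \<le> \<beta>m t s)"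

section \<open>The constants\<close>

text \<open>Suprema and integrals of nonnegative quantities are taken in \<^typ>\<open>ennreal\<close>, so that
  finiteness is a genuine condition (and \<open>Lip\<close> is \<open>0\<close> on the trivial space).
  There \<open>N / 0 = \<infinity>\<close> for \<open>N > 0\<close>, so an estimate with factor \<open>N / \<omega>\<close> is void when \<open>\<omega> = 0\<close>.\<close>

definition Lip :: "('a::real_normed_vector \<Rightarrow> 'a) \<Rightarrow> ennreal" where
  "Lip g = (SUP (x, y)\<in>{(x, y). x \<noteq> y}. ennreal (norm (g x - g y) / norm (x - y)))"

definition sigma_integrand ::
    "(real \<Rightarrow> real \<Rightarrow> real) \<Rightarrow> (real \<Rightarrow> 'a::real_normed_vector \<Rightarrow> 'a) \<Rightarrow>
     real \<Rightarrow> real \<Rightarrow> real \<Rightarrow> ennreal" where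
  "sigma_integrand \<alpha> f t s r =
     ennreal (\<alpha> t r) * Lip (f r) * ennreal (\<alpha> r s) / ennreal (\<alpha> t s)"

definition omega_integrand ::
    "(real \<Rightarrow> real \<Rightarrow> real) \<Rightarrow> (real \<Rightarrow> real \<Rightarrow> real) \<Rightarrow>
     (real \<Rightarrow> 'a::real_normed_vector \<Rightarrow> 'a) \<Rightarrow> real \<Rightarrow> real \<Rightarrow> ennreal" where
  "omega_integrand \<alpha> \<beta> f s r = ennreal (\<beta> s r) * Lip (f r) * ennreal (\<alpha> r s)"

text \<open>What it means for the integrals in \<open>sigma_const\<close> and \<open>omega_const\<close> below to be defined as Lebesgue
  integrals with values in \<open>[0, \<infinity>]\<close>: no regularity of the bounds is assumed otherwise.\<close>

definition integrals_defined ::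
    "(real \<Rightarrow> real \<Rightarrow> real) \<Rightarrow> (real \<Rightarrow> real \<Rightarrow> real) \<Rightarrow> (real \<Rightarrow> real \<Rightarrow> real) \<Rightarrow>
     (real \<Rightarrow> 'a::real_normed_vector \<Rightarrow> 'a) \<Rightarrow> bool" where
  "integrals_defined \<alpha> \<beta>p \<beta>m f \<longleftrightarrow>
     (\<forall>t s. sigma_integrand \<alpha> f t s \<in> borel_measurable (lebesgue_on (closed_segment s t))) \<and>
     (\<forall>s. omega_integrand \<alpha> \<beta>p f s \<in> borel_measurable (lebesgue_on {..s})) \<and>
     (\<forall>s. omega_integrand \<alpha> \<beta>m f s \<in> borel_measurable (lebesgue_on {s..}))"

text \<open>The integrand is nonnegative, so the absolute value of its oriented integral from \<open>s\<close> to
  \<open>t\<close> is its integral over the segment with endpoints \<open>s\<close> and \<open>t\<close>, in either order.\<close>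

definition sigma_const ::
    "(real \<Rightarrow> real \<Rightarrow> real) \<Rightarrow> (real \<Rightarrow> 'a::real_normed_vector \<Rightarrow> 'a) \<Rightarrow> ennreal" where
  "sigma_const \<alpha> f =
     (SUP (t, s)\<in>UNIV. \<integral>\<^sup>+r\<in>closed_segment s t. sigma_integrand \<alpha> f t s r \<partial>lebesgue)"

definition omega_const ::
    "(real \<Rightarrow> real \<Rightarrow> real) \<Rightarrow> (real \<Rightarrow> real \<Rightarrow> real) \<Rightarrow> (real \<Rightarrow> real \<Rightarrow> real) \<Rightarrow>
     (real \<Rightarrow> 'a::real_normed_vector \<Rightarrow> 'a) \<Rightarrow> ennreal" where
  "omega_const \<alpha> \<beta>p \<beta>m f =
     (SUP s. (\<integral>\<^sup>+r\<in>{..s}. omega_integrand \<alpha> \<beta>p f s r \<partial>lebesgue) +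
             (\<integral>\<^sup>+r\<in>{s..}. omega_integrand \<alpha> \<beta>m f s r \<partial>lebesgue))"

section \<open>The flow of the perturbed equation\<close>

definition perturbed_solution ::
    "(real \<Rightarrow> 'a::banach \<Rightarrow>\<^sub>L 'a) \<Rightarrow> (real \<Rightarrow> 'a \<Rightarrow> 'a) \<Rightarrow> (real \<Rightarrow> 'a) \<Rightarrow> bool" where
  "perturbed_solution A f v \<longleftrightarrow>
     (\<forall>t. (v has_vector_derivative (A t (v t) + f t (v t))) (at t))"

definition well_posed :: "(real \<Rightarrow> 'a::banach \<Rightarrow>\<^sub>L 'a) \<Rightarrow> (real \<Rightarrow> 'a \<Rightarrow> 'a) \<Rightarrow> bool" where
  "well_posed A f \<longleftrightarrow> (\<forall>s x. \<exists>!v. perturbed_solution A f v \<and> v s = x)"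

text \<open>\<open>flow A f t s x\<close> is the value at time \<open>t\<close> of the only solution that equals \<open>x\<close> at time
  \<open>s\<close>. Triples \<open>(\<xi>, \<eta>p, \<eta>m)\<close> in the product of the three subspaces at a given time are
  identified with \<open>\<xi> + \<eta>p + \<eta>m\<close> throughout.\<close>

definition flow :: "(real \<Rightarrow> 'a::banach \<Rightarrow>\<^sub>L 'a) \<Rightarrow> (real \<Rightarrow> 'a \<Rightarrow> 'a) \<Rightarrow> real \<Rightarrow> real \<Rightarrow> 'a \<Rightarrow> 'a" where
  "flow A f t s x = (THE v. perturbed_solution A f v \<and> v s = x) t"

definition Psi :: "(real \<Rightarrow> 'a::banach \<Rightarrow>\<^sub>L 'a) \<Rightarrow> (real \<Rightarrow> 'a \<Rightarrow> 'a) \<Rightarrow> real \<Rightarrow> real \<times> 'a \<Rightarrow> real \<times> 'a" where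
  "Psi A f \<tau> = (\<lambda>(s, x). (s + \<tau>, flow A f (s + \<tau>) s x))"

section \<open>The class of graphs\<close>

definition G_set :: "(real \<Rightarrow> 'a::banach \<Rightarrow>\<^sub>L 'a) \<Rightarrow> (real \<times> 'a) set" where
  "G_set P = (SIGMA t:UNIV. range (blinfun_apply (P t)))"

text \<open>A function on \<open>G_set P\<close> is represented by the total function that is \<open>undefined\<close> outside
  \<open>G_set P\<close>, so that equality of representatives is equality of functions on \<open>G_set P\<close>.\<close>

definition A_set ::
    "(real \<Rightarrow> 'a::banach \<Rightarrow>\<^sub>L 'a) \<Rightarrow> (real \<Rightarrow> 'a \<Rightarrow>\<^sub>L 'a) \<Rightarrow> (real \<Rightarrow> 'a \<Rightarrow>\<^sub>L 'a) \<Rightarrow> real \<Rightarrow>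
     (real \<times> 'a \<Rightarrow> 'a) set" where
  "A_set P Qp Qm N = {\<phi> \<in> extensional (G_set P).
     continuous_on (G_set P) \<phi> \<and>
     (\<forall>t. \<phi> (t, 0) = 0) \<and>
     (\<forall>(t, \<xi>) \<in> G_set P. \<phi> (t, \<xi>) \<in> {a + b |a b. a \<in> range (Qp t) \<and> b \<in> range (Qm t)}) \<and>
     (\<forall>t \<xi> \<xi>'. (t, \<xi>) \<in> G_set P \<longrightarrow> (t, \<xi>') \<in> G_set P \<longrightarrow>
        norm (\<phi> (t, \<xi>) - \<phi> (t, \<xi>')) \<le> N * norm (\<xi> - \<xi>'))}"

definition graph :: "(real \<Rightarrow> 'a::banach \<Rightarrow>\<^sub>L 'a) \<Rightarrow> (real \<times> 'a \<Rightarrow> 'a) \<Rightarrow> (real \<times> 'a) set" where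
  "graph P \<phi> = {(s, \<xi> + \<phi> (s, \<xi>)) |s \<xi>. (s, \<xi>) \<in> G_set P}"

end

theory Submission
  imports Defs
begin

text \<open>
  The proof is a Lyapunov--Perron argument. Suppose that the graph of \<open>\<phi>\<close> is invariant, and let \<open>v\<close>
  be a solution on it that starts at \<open>\<xi> + \<phi> (s, \<xi>)\<close>. Projecting the variation of constants formula
  for \<open>v\<close> to the central spaces gives a closed equation for \<open>x t = P t (v t)\<close>:
  \<open>x t = T t s \<xi> + \<integral>\<^sub>s\<^sup>t T t r (P r (f r (x r + \<phi> (r, x r)))) dr\<close>. Projecting it to the two other
  directions and letting the base time tend to \<open>-\<infinity>\<close> along \<open>Qp\<close> and to \<open>+\<infinity>\<close> along \<open>Qm\<close>, where
  \<open>\<beta>p s r * \<alpha> r s\<close> and \<open>\<beta>m s r * \<alpha> r s\<close> make the boundary terms vanish, leaves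
  \<open>\<phi> (s, \<xi>) = \<integral> T s r (Qp r (f r (v r))) dr - \<integral> T s r (Qm r (f r (v r))) dr\<close>,
  with the first integral over \<open>r \<le> s\<close> and the second over \<open>r \<ge> s\<close>. So \<open>\<phi>\<close> is a fixed point of the map
  \<open>graph_transform\<close> that solves the central equation along a given graph and then evaluates these two
  integrals (\<open>invariant_imp_fixed\<close>). Conversely, for a fixed point the two integrals, read as functions of
  time along a central solution, satisfy the transverse part of the variation of constants formula
  (\<open>transverse_mild\<close>), so the graph is invariant (\<open>flow_on_invariant_graph\<close>).

  All estimates compare with the weight \<open>\<alpha> t s\<close>. The constant \<open>\<sigma>\<close> bounds the operator
  that defines the central equation in this weight, which gives existence (\<open>reduced_exists\<close>) and,
  by a Gronwall argument (\<open>weighted_gronwall\<close>), the growth estimate with the factor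
  \<open>M = 1 / (1 - \<sigma> * (1 + N))\<close>. The constant \<open>\<omega>\<close> then bounds the transverse integrals. Slopes bounded by
  \<open>N\<close> are preserved if \<open>\<omega> * (1 + N) * M \<le> N\<close>, and \<open>graph_transform\<close> contracts the norm
  \<open>sup \<parallel>\<phi> (t, \<xi>)\<parallel> / \<parallel>\<xi>\<parallel>\<close> if \<open>\<omega> * M\<^sup>2 < 1\<close>. Both hold for a suitable \<open>N\<close> in \<open>(0, 1)\<close> because
  \<open>2 * \<sigma> + 2 * \<omega> < 1\<close> (\<open>Lipschitz_constant_exists\<close>).

  The bounds \<open>\<alpha>\<close>, \<open>\<beta>p\<close>, \<open>\<beta>m\<close> may be irregular, even locally unbounded, so continuity never comes from
  them. Central solutions are continuous because the weighted estimates at a fixed time \<open>b\<close> control the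
  whole segment between \<open>s\<close> and \<open>b\<close>. The transformed graph is continuous in time because, along a
  central solution, it satisfies an integral equation over compact intervals (\<open>graph_transform_isCont\<close>).
\<close>

section \<open>Oriented integrals of continuous functions\<close>

text \<open>The Henstock--Kurzweil integral makes sense for values in a Banach space that need not be separable.\<close>
definition oint :: "real \<Rightarrow> real \<Rightarrow> (real \<Rightarrow> 'a::banach) \<Rightarrow> 'a" where
  "oint s t g = (if s \<le> t then integral {s..t} g else - integral {t..s} g)"

lemma oint_self [simp]: "oint s s g = 0"
  by (simp add: oint_def)

lemma oint_zero [simp]: "oint s t (\<lambda>_. 0) = 0"
  by (simp add: oint_def)

lemma oint_eq_diff:
  fixes g :: "real \<Rightarrow> 'a::banach"
  assumes "continuous_on UNIV g" "a \<le> s" "a \<le> t"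
  shows "oint s t g = integral {a..t} g - integral {a..s} g"
proof -
  have int: "g integrable_on {u..v}" for u v
    using assms(1) by (meson continuous_on_subset integrable_continuous_real subset_UNIV)
  show ?thesis
  proof (cases "s \<le> t")
    case True
    then show ?thesis
      using Henstock_Kurzweil_Integration.integral_combine[OF assms(2) True int]
      by (simp add: oint_def algebra_simps)
  next
    case False
    then show ?thesis
      using Henstock_Kurzweil_Integration.integral_combine[OF assms(3) _ int, of s]
      by (simp add: oint_def algebra_simps)
  qed
qed

lemma oint_has_vector_derivative:
  fixes g :: "real \<Rightarrow> 'a::banach"
  assumes g: "continuous_on UNIV g"
  shows "((\<lambda>t. oint s t g) has_vector_derivative g t) (at t)"
proof -
  define a where "a = min s t - 1"
  define b where "b = max s t + 1"
  have "((\<lambda>u. integral {a..u} g) has_vector_derivative g t) (at t within {a..b})"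
    using g continuous_on_subset
    by (intro integral_has_vector_derivative) (auto simp: a_def b_def)
  then have "((\<lambda>u. integral {a..u} g - integral {a..s} g) has_vector_derivative g t) (at t within {a..b})"
    by (auto intro!: derivative_eq_intros)
  then have "((\<lambda>u. oint s u g) has_vector_derivative g t) (at t within {a..b})"
    by (rule has_vector_derivative_transform[rotated 2])
       (auto simp: a_def b_def intro!: oint_eq_diff g)
  moreover have "at t within {a..b} = at t"
    by (rule at_within_interior) (auto simp: a_def b_def)
  ultimately show ?thesis by simp
qed

lemma oint_unique:
  fixes h :: "real \<Rightarrow> 'a::banach"
  assumes "continuous_on UNIV g" "\<And>t. (h has_vector_derivative g t) (at t)"
  shows "oint s t g = h t - h s"
proof -
  have "((\<lambda>t. oint s t g - h t) has_derivative (\<lambda>_. 0)) (at t within UNIV)" for t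
    using has_vector_derivative_diff[OF oint_has_vector_derivative[OF assms(1)] assms(2)]
    by (simp add: has_vector_derivative_def)
  from has_derivative_zero_unique_connected[OF open_UNIV connected_UNIV this UNIV_I UNIV_I, of t s]
  show ?thesis by (simp add: algebra_simps)
qed

lemma oint_combine:
  fixes g :: "real \<Rightarrow> 'a::banach"
  assumes "continuous_on UNIV g"
  shows "oint a b g + oint b c g = oint a c g"
  using oint_unique[OF assms oint_has_vector_derivative[OF assms], of b c a] by simp

lemma oint_swap:
  "continuous_on UNIV g \<Longrightarrow> oint b a g = - oint a b g"
  using oint_combine[of g a b a] by (simp add: eq_neg_iff_add_eq_0 add.commute)

lemma oint_bounded_linear:
  fixes g :: "real \<Rightarrow> 'a::banach" and h :: "'a \<Rightarrow> 'b::banach"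
  assumes h: "bounded_linear h" and g: "continuous_on UNIV g"
  shows "oint s t (\<lambda>r. h (g r)) = h (oint s t g)"
proof -
  have "oint s t (\<lambda>r. h (g r)) = h (oint s t g) - h (oint s s g)"
    by (rule oint_unique[where h = "\<lambda>t. h (oint s t g)"])
       (auto intro!: bounded_linear.continuous_on[OF h] g
         bounded_linear.has_vector_derivative[OF h] oint_has_vector_derivative)
  then show ?thesis by (simp add: linear_0[OF bounded_linear.linear[OF h]])
qed

lemmas oint_blinfun = oint_bounded_linear[OF blinfun.bounded_linear_right]

lemma oint_add:
  fixes g :: "real \<Rightarrow> 'a::banach"
  assumes "continuous_on UNIV g" "continuous_on UNIV h"
  shows "oint s t (\<lambda>r. g r + h r) = oint s t g + oint s t h"
proof -
  have "oint s t (\<lambda>r. g r + h r) = (oint s t g + oint s t h) - (oint s s g + oint s s h)"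
    by (rule oint_unique[where h = "\<lambda>t. oint s t g + oint s t h"])
       (auto intro!: continuous_intros assms derivative_intros oint_has_vector_derivative)
  then show ?thesis by simp
qed

lemma oint_diff:
  fixes g :: "real \<Rightarrow> 'a::banach"
  assumes "continuous_on UNIV g" "continuous_on UNIV h"
  shows "oint s t (\<lambda>r. g r - h r) = oint s t g - oint s t h"
proof -
  have "oint s t (\<lambda>r. g r - h r) = (oint s t g - oint s t h) - (oint s s g - oint s s h)"
    by (rule oint_unique[where h = "\<lambda>t. oint s t g - oint s t h"])
       (auto intro!: continuous_intros assms derivative_intros oint_has_vector_derivative)
  then show ?thesis by simp
qed

text \<open>The endpoint \<open>b\<close> may lie beyond \<open>t\<close>: a bound at the single time \<open>b\<close> then controls all
  intermediate times, which is how locally uniform estimates are obtained below.\<close>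
lemma norm_oint_le_oint:
  fixes g :: "real \<Rightarrow> 'a::banach" and G :: "real \<Rightarrow> real"
  assumes "continuous_on UNIV g" "continuous_on UNIV G"
    and "\<And>r. r \<in> closed_segment s t \<Longrightarrow> norm (g r) \<le> G r"
    and "\<And>r. r \<in> closed_segment s b \<Longrightarrow> 0 \<le> G r" "t \<in> closed_segment s b"
  shows "norm (oint s t g) \<le> \<bar>oint s b G\<bar>"
proof -
  have int: "g integrable_on {u..v}" "G integrable_on {u..v}" for u v
    using assms(1,2) by (meson continuous_on_subset integrable_continuous_real subset_UNIV)+
  show ?thesis
  proof (cases "s \<le> t")
    case True
    show ?thesis
    proof (cases "s \<le> b")
      case sb: True
      have "norm (integral {s..t} g) \<le> integral {s..t} G"
        using True assms(3) by (intro integral_norm_bound_integral int) (auto simp: closed_segment_eq_real_ivl)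
      also have "\<dots> \<le> integral {s..b} G"
        using True sb assms(4,5) by (intro integral_subset_le int) (auto simp: closed_segment_eq_real_ivl)
      finally show ?thesis using True sb by (simp add: oint_def)
    next
      case False
      then show ?thesis using True assms(5) by (auto simp: closed_segment_eq_real_ivl)
    qed
  next
    case False
    then have bt: "b \<le> t" and bs: "\<not> s \<le> b"
      using assms(5) by (auto simp: closed_segment_eq_real_ivl split: if_splits)
    have "norm (integral {t..s} g) \<le> integral {t..s} G"
      using False assms(3) by (intro integral_norm_bound_integral int) (auto simp: closed_segment_eq_real_ivl)
    also have "\<dots> \<le> integral {b..s} G"
      using False bt bs assms(4,5) by (intro integral_subset_le int) (auto simp: closed_segment_eq_real_ivl)
    finally show ?thesis using False bs by (simp add: oint_def)
  qed
qed

text \<open>The next two lemmas connect oriented integrals of continuous functions with the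
  Lebesgue integrals over \<open>[0, \<infinity>]\<close> in which the hypotheses of the theorem are phrased.\<close>
lemma nn_integral_eq_abs_oint:
  fixes G :: "real \<Rightarrow> real"
  assumes "continuous_on UNIV G" "\<And>r. 0 \<le> G r"
  shows "(\<integral>\<^sup>+r\<in>closed_segment s t. ennreal (G r) \<partial>lebesgue) = ennreal \<bar>oint s t G\<bar>"
proof -
  have *: "(\<integral>\<^sup>+r\<in>{u..v}. ennreal (G r) \<partial>lebesgue) = ennreal (integral {u..v} G)" for u v
  proof -
    have "(G has_integral (integral {u..v} G)) {u..v}"
      using assms(1) by (meson continuous_on_subset integrable_continuous_real subset_UNIV integrable_integral)
    then have "(\<integral>\<^sup>+r. ennreal (indicator {u..v} r * G r) \<partial>lborel) = ennreal (integral {u..v} G)"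
      using assms(2) by (intro nn_integral_has_integral_lebesgue) auto
    moreover have "ennreal (indicator {u..v} r * G r) = ennreal (G r) * indicator {u..v} r" for r
      by (simp add: indicator_def)
    moreover have "(\<lambda>r. ennreal (G r) * indicator {u..v} r) \<in> borel_measurable lborel"
      using borel_measurable_continuous_onI[OF assms(1)] by measurable
    ultimately show ?thesis by (simp add: nn_integral_completion)
  qed
  have "0 \<le> integral {u..v} G" for u v
    using assms by (intro Henstock_Kurzweil_Integration.integral_nonneg integrable_continuous_real)
      (auto intro: continuous_on_subset)
  then show ?thesis using *[of s t] *[of t s]
    by (auto simp: oint_def closed_segment_eq_real_ivl)
qed

lemma abs_oint_le_nn_integral:
  fixes G :: "real \<Rightarrow> real"
  assumes G: "continuous_on UNIV G" "\<And>r. 0 \<le> G r"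
    and h: "h \<in> borel_measurable (lebesgue_on S)" "S \<in> sets lebesgue"
    and S: "closed_segment s t \<subseteq> S"
    and le: "\<And>r. r \<in> closed_segment s t \<Longrightarrow> ennreal (G r) \<le> ennreal c * h r"
    and "0 \<le> c" and C: "(\<integral>\<^sup>+r\<in>S. h r \<partial>lebesgue) \<le> ennreal C" "0 \<le> C"
  shows "\<bar>oint s t G\<bar> \<le> c * C"
proof -
  have "ennreal \<bar>oint s t G\<bar> = (\<integral>\<^sup>+r\<in>closed_segment s t. ennreal (G r) \<partial>lebesgue)"
    by (rule nn_integral_eq_abs_oint[symmetric]) (use G in auto)
  also have "\<dots> \<le> (\<integral>\<^sup>+r. ennreal c * (h r * indicator S r) \<partial>lebesgue)"
    using le S by (intro nn_integral_mono) (auto simp: indicator_def)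
  also have "\<dots> = ennreal c * (\<integral>\<^sup>+r\<in>S. h r \<partial>lebesgue)"
    using h by (intro nn_integral_cmult) (simp add: borel_measurable_restrict_space_iff_ennreal)
  also have "\<dots> \<le> ennreal c * ennreal C"
    using C by (intro mult_left_mono) auto
  finally show ?thesis using assms by (simp add: ennreal_mult[symmetric] ennreal_le_iff)
qed

lemma oint_sgn:
  fixes G :: "real \<Rightarrow> real"
  assumes "continuous_on UNIV G" "\<And>r. 0 \<le> G r"
  shows "0 \<le> (t - s) * oint s t G"
proof -
  have "0 \<le> integral {u..v} G" for u v
    using assms by (intro Henstock_Kurzweil_Integration.integral_nonneg integrable_continuous_real)
      (auto intro: continuous_on_subset)
  then show ?thesis by (auto simp: oint_def mult_nonneg_nonneg mult_nonpos_nonneg)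
qed

text \<open>An absolutely convergent improper integral converges: the oriented integral \<open>V n\<close> of the norm is monotone and
  bounded, hence Cauchy, and it dominates the increments of the vector-valued integral. The sign \<open>e\<close>
  selects the half-line; the endpoints \<open>e * n\<close> are the same for every \<open>s\<close>, so
  that limits for different \<open>s\<close> can be compared term by term.\<close>
lemma halfline_limit:
  fixes g :: "real \<Rightarrow> 'a::banach"
  assumes g: "continuous_on UNIV g" and e: "e = 1 \<or> e = -1"
    and B: "\<And>a. 0 \<le> e * (a - s) \<Longrightarrow> \<bar>oint s a (\<lambda>r. norm (g r))\<bar> \<le> B"
  shows "\<exists>l. (\<lambda>n. oint s (e * real n) g) \<longlonglongrightarrow> l \<and> norm l \<le> B"
proof -
  let ?a = "\<lambda>n. e * real n" and ?G = "\<lambda>r. norm (g r)"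
  define V where "V n = e * oint s (?a n) ?G" for n
  have G: "continuous_on UNIV ?G" by (intro continuous_intros g)
  have far: "0 \<le> e * (?a n - s)" if "real n \<ge> \<bar>s\<bar>" for n
    using that e by auto
  have step: "norm (oint s (?a n) g - oint s (?a m) g) \<le> V n - V m" if "m \<le> n" for m n
  proof -
    have "norm (oint s (?a n) g - oint s (?a m) g) = norm (oint (?a m) (?a n) g)"
      using oint_combine[OF g, of s "?a m" "?a n"] by (metis add_diff_cancel_left')
    also have "\<dots> \<le> \<bar>oint (?a m) (?a n) ?G\<bar>"
      by (rule norm_oint_le_oint[OF g G]) auto
    also have "\<dots> = e * oint (?a m) (?a n) ?G"
    proof (cases "m = n")
      case False
      then have "0 < real n - real m" using that by simp
      moreover have "0 \<le> (real n - real m) * (e * oint (?a m) (?a n) ?G)"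
        using oint_sgn[OF G, of "?a n" "?a m"] by (simp add: algebra_simps)
      ultimately have "0 \<le> e * oint (?a m) (?a n) ?G"
        by (simp add: zero_le_mult_iff)
      then show ?thesis using e by auto
    qed simp
    also have "\<dots> = V n - V m"
      unfolding V_def right_diff_distrib[symmetric]
      using oint_combine[OF G, of s "?a m" "?a n"] by simp
    finally show ?thesis .
  qed
  have "incseq V"
    unfolding incseq_def using step norm_ge_zero by (metis diff_ge_0_iff_ge order_trans)
  moreover have "V n \<le> B" for n
  proof -
    obtain k where k: "real k \<ge> \<bar>s\<bar>" using real_arch_simple by blast
    have "V n \<le> V (max n k)" using \<open>incseq V\<close> by (simp add: incseqD)
    also have "\<dots> \<le> \<bar>oint s (?a (max n k)) ?G\<bar>" using e by (auto simp: V_def)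
    also have "\<dots> \<le> B" using k by (intro B far) auto
    finally show ?thesis .
  qed
  ultimately have "Cauchy V"
    using incseq_convergent[of V B] LIMSEQ_imp_Cauchy by blast
  have "Cauchy (\<lambda>n. oint s (?a n) g)"
  proof (rule metric_CauchyI)
    fix d :: real assume "0 < d"
    then obtain k where k: "\<And>m n. m \<ge> k \<Longrightarrow> n \<ge> k \<Longrightarrow> dist (V m) (V n) < d"
      using \<open>Cauchy V\<close> metric_CauchyD by blast
    have "norm (oint s (?a n) g - oint s (?a m) g) < d" if "k \<le> m" "m \<le> n" for m n
      using step[OF that(2)] k[of m n] that by (auto simp: dist_real_def)
    then show "\<exists>k. \<forall>m\<ge>k. \<forall>n\<ge>k. dist (oint s (?a m) g) (oint s (?a n) g) < d"
      by (metis dist_norm dist_commute nle_le)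
  qed
  then obtain l where l: "(\<lambda>n. oint s (?a n) g) \<longlonglongrightarrow> l"
    using Cauchy_convergent convergent_def by blast
  have "norm (oint s (?a n) g) \<le> B" if "real n \<ge> \<bar>s\<bar>" for n
    using norm_oint_le_oint[OF g G, of s "?a n" "?a n"] B[OF far[OF that]] by simp
  then have "\<forall>\<^sub>F n in sequentially. norm (oint s (?a n) g) \<le> B"
    using real_nat_ceiling_ge
    by (intro eventually_sequentiallyI[of "nat \<lceil>\<bar>s\<bar>\<rceil>"]) (simp add: nat_le_iff ceiling_le_iff)
  then have "norm l \<le> B"
    by (intro tendsto_upperbound[OF tendsto_norm[OF l]]) auto
  with l show ?thesis by blast
qed

section \<open>Sequences with geometrically decreasing increments\<close>

lemma geometric_increments_tail:
  fixes y :: "nat \<Rightarrow> 'a::real_normed_vector"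
  assumes inc: "\<And>n. norm (y (Suc n) - y n) \<le> C * k ^ n" and k: "0 \<le> k" "k < 1"
    and l: "y \<longlonglongrightarrow> l"
  shows "norm (y n - l) \<le> C / (1 - k) * k ^ n"
proof -
  have C: "0 \<le> C" using order_trans[OF norm_ge_zero inc[of 0]] by simp
  have part: "norm (y (n + m) - y n) \<le> C / (1 - k) * k ^ n * (1 - k ^ m)" for m
  proof (induction m)
    case (Suc m)
    have "norm (y (n + Suc m) - y n) \<le> norm (y (Suc (n + m)) - y (n + m)) + norm (y (n + m) - y n)"
      using norm_triangle_ineq[of "y (Suc (n + m)) - y (n + m)" "y (n + m) - y n"] by simp
    also have "\<dots> \<le> C * k ^ (n + m) + C / (1 - k) * k ^ n * (1 - k ^ m)"
      by (intro add_mono inc Suc)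
    also have "\<dots> = C / (1 - k) * k ^ n * (1 - k ^ Suc m)"
      using k by (simp add: field_simps power_add)
    finally show ?case .
  qed simp
  have "norm (y (n + m) - y n) \<le> C / (1 - k) * k ^ n" for m
    using part[of m] k C mult_left_mono[of "1 - k ^ m" 1 "C / (1 - k) * k ^ n"] by simp
  moreover have "(\<lambda>m. y (n + m)) \<longlonglongrightarrow> l"
    using LIMSEQ_ignore_initial_segment[OF l, of n] by (simp add: add.commute)
  ultimately have "norm (l - y n) \<le> C / (1 - k) * k ^ n"
    by (intro tendsto_upperbound[OF tendsto_norm[OF tendsto_diff[OF _ tendsto_const]]]) auto
  then show ?thesis by (simp add: norm_minus_commute)
qed

lemma geometric_increments_convergent:
  fixes y :: "nat \<Rightarrow> 'a::banach"
  assumes inc: "\<And>n. norm (y (Suc n) - y n) \<le> C * k ^ n" and k: "0 \<le> k" "k < 1"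
  shows "convergent y"
proof -
  have "summable (\<lambda>n. y (Suc n) - y n)"
    by (rule summable_comparison_test'[OF summable_mult[OF summable_geometric]]) (use inc k in auto)
  then have "convergent (\<lambda>n. \<Sum>i<n. y (Suc i) - y i)"
    by (simp add: summable_iff_convergent)
  then have "convergent (\<lambda>n. (\<Sum>i<n. y (Suc i) - y i) + y 0)"
    by (intro convergent_add convergent_const)
  then show ?thesis by (simp add: sum_lessThan_telescope)
qed

section \<open>Evolution operators and variation of constants\<close>

text \<open>The variation of constants formula is required between any two times, so that the base
  time of a solution can be moved freely.\<close>
definition mild_solution ::
    "(real \<Rightarrow> real \<Rightarrow> 'a::banach \<Rightarrow>\<^sub>L 'a) \<Rightarrow> (real \<Rightarrow> 'a) \<Rightarrow> (real \<Rightarrow> 'a) \<Rightarrow> bool" where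
  "mild_solution T g v \<longleftrightarrow> (\<forall>s t. v t = T t s (v s) + oint s t (\<lambda>r. T t r (g r)))"

lemma continuous_on_blinfun_compose [continuous_intros]:
  "continuous_on S f \<Longrightarrow> continuous_on S g \<Longrightarrow> continuous_on S (\<lambda>x. f x o\<^sub>L g x)"
  by (rule bounded_bilinear.continuous_on[OF bounded_bilinear_blinfun_compose])

text \<open>On an interval so short that \<open>K * d \<le> 1 / 2\<close>, the mean value inequality gives
  \<open>sup \<parallel>v\<parallel> \<le> \<parallel>v s\<parallel> + sup \<parallel>v\<parallel> / 2\<close>. The resulting bound is uniform in the solution, so it turns the pointwise
  differentiability of \<open>\<lambda>t. T t s x\<close> into continuity in operator norm.\<close>
lemma linear_solution_local_bound:
  fixes A :: "real \<Rightarrow> 'a::banach \<Rightarrow>\<^sub>L 'a"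
  assumes v: "linear_solution A v"
    and K: "\<And>r. r \<in> {s - d..s + d} \<Longrightarrow> norm (A r) \<le> K" "0 \<le> K" "K * d \<le> 1 / 2"
    and t: "\<bar>t - s\<bar> \<le> d"
  shows "norm (v t - v s) \<le> 2 * K * \<bar>t - s\<bar> * norm (v s)"
proof -
  let ?J = "{s - d..s + d}"
  have d: "0 \<le> d" using t by linarith
  have der: "(v has_derivative (\<lambda>h. h *\<^sub>R A r (v r))) (at r within ?J)" for r
    using v by (auto simp: linear_solution_def has_vector_derivative_def intro: has_derivative_at_withinI)
  have "continuous_on ?J (\<lambda>r. norm (v r))"
    by (intro continuous_on_norm has_derivative_continuous_on[OF der])
  then obtain u where u: "u \<in> ?J" "\<And>r. r \<in> ?J \<Longrightarrow> norm (v r) \<le> norm (v u)"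
    using continuous_attains_sup[of ?J "\<lambda>r. norm (v r)"] d by auto
  have onorm: "onorm (\<lambda>h. h *\<^sub>R A r (v r)) \<le> K * norm (v u)" if "r \<in> ?J" for r
  proof (rule onorm_le)
    fix h
    have "norm (A r (v r)) \<le> norm (A r) * norm (v r)" by (rule norm_blinfun)
    also have "\<dots> \<le> K * norm (v u)" using K(1,2) u(2) that by (intro mult_mono) auto
    finally show "norm (h *\<^sub>R A r (v r)) \<le> K * norm (v u) * norm h"
      by (simp add: mult.commute mult_left_mono)
  qed
  have lip: "norm (v r - v s) \<le> K * norm (v u) * norm (r - s)" if "r \<in> ?J" for r
    using d that by (intro differentiable_bound[OF convex_real_interval(5) der onorm]) auto
  have "norm (v u) \<le> norm (v s) + norm (v u - v s)"
    by (metis add.commute diff_add_cancel norm_triangle_ineq)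
  also have "\<dots> \<le> norm (v s) + K * norm (v u) * d"
    using lip[OF u(1)] u(1) K(2) 
    by (intro add_left_mono order_trans[OF lip[OF u(1)]] mult_left_mono) (auto simp: abs_le_iff)
  also have "\<dots> \<le> norm (v s) + 1 / 2 * norm (v u)"
    using mult_right_mono[OF K(3), of "norm (v u)"] by (simp add: algebra_simps)
  finally have "norm (v u) \<le> 2 * norm (v s)" by simp
  then have "K * norm (v u) * norm (t - s) \<le> K * (2 * norm (v s)) * norm (t - s)"
    using K(2) by (intro mult_right_mono mult_left_mono) auto
  with lip[of t] t show ?thesis by (auto simp: abs_le_iff algebra_simps)
qed

locale evolution =
  fixes A :: "real \<Rightarrow> 'a::banach \<Rightarrow>\<^sub>L 'a" and T :: "real \<Rightarrow> real \<Rightarrow> 'a \<Rightarrow>\<^sub>L 'a"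
  assumes A_cont: "continuous_on UNIV A" and ev: "evolution_operator A T"
begin

lemma linear_T: "linear_solution A (\<lambda>t. T t s x)"
  using ev by (simp add: evolution_operator_def)

lemma linear_solution_eq: "linear_solution A v \<Longrightarrow> v t = T t s (v s)"
  using ev unfolding evolution_operator_def by blast

lemma T_self [simp]: "T s s = id_blinfun"
  using ev by (intro blinfun_eqI) (simp add: evolution_operator_def)

lemma T_T [simp]: "T t s (T s r x) = T t r x"
  using ev linear_T[of r x] unfolding evolution_operator_def by metis

lemma T_comp: "T t s o\<^sub>L T s r = T t r"
  by (intro blinfun_eqI) simp

lemma T_near_diagonal:
  "\<exists>K\<ge>0. \<exists>d>0. \<forall>s t. \<bar>s - s0\<bar> \<le> d \<longrightarrow> \<bar>t - s\<bar> \<le> d \<longrightarrow> norm (T t s - id_blinfun) \<le> K * \<bar>t - s\<bar>"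
proof -
  have "continuous_on {s0 - 1..s0 + 1} (\<lambda>r. norm (A r))"
    using A_cont by (intro continuous_on_norm) (rule continuous_on_subset, auto)
  then obtain u where u: "\<And>r. r \<in> {s0 - 1..s0 + 1} \<Longrightarrow> norm (A r) \<le> norm (A u)"
    using continuous_attains_sup[of "{s0 - 1..s0 + 1}" "\<lambda>r. norm (A r)"] by fastforce
  define K where "K = norm (A u) + 1"
  define d where "d = 1 / (2 * K)"
  have K: "K \<ge> 1" by (simp add: K_def)
  then have d: "0 < d" "d \<le> 1 / 2" "K * d = 1 / 2" by (auto simp: d_def field_simps)
  have "norm (T t s - id_blinfun) \<le> 2 * K * \<bar>t - s\<bar>" if "\<bar>s - s0\<bar> \<le> d" "\<bar>t - s\<bar> \<le> d" for s t
  proof (rule norm_blinfun_bound)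
    fix x
    have "norm (T t s x - T s s x) \<le> 2 * K * \<bar>t - s\<bar> * norm (T s s x)"
    proof (rule linear_solution_local_bound[OF linear_T])
      fix r assume "r \<in> {s - d..s + d}"
      then have "r \<in> {s0 - 1..s0 + 1}" using that(1) d(2) by (auto simp: abs_le_iff)
      then show "norm (A r) \<le> K" using u[of r] by (simp add: K_def)
    qed (use K d that in auto)
    then show "norm ((T t s - id_blinfun) x) \<le> 2 * K * \<bar>t - s\<bar> * norm x"
      by (simp add: blinfun.diff_left)
  qed (use K in auto)
  then show ?thesis using K d(1) by (intro exI[of _ "2 * K"] conjI exI[of _ d]) auto
qed

lemma T_tendsto_id:
  "((\<lambda>t. T t s0) \<longlongrightarrow> id_blinfun) (at s0)" "((\<lambda>s. T s0 s) \<longlongrightarrow> id_blinfun) (at s0)"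
proof -
  obtain K d where K: "0 \<le> K" "0 < d"
      "\<And>s t. \<bar>s - s0\<bar> \<le> d \<Longrightarrow> \<bar>t - s\<bar> \<le> d \<Longrightarrow> norm (T t s - id_blinfun) \<le> K * \<bar>t - s\<bar>"
    using T_near_diagonal by metis
  have ev: "\<forall>\<^sub>F t in at s0. \<bar>t - s0\<bar> \<le> d"
    using K(2) by (auto simp: eventually_at dist_real_def intro!: exI[of _ d])
  have lim: "((\<lambda>t. K * \<bar>t - s0\<bar>) \<longlongrightarrow> 0) (at s0)"
    by (rule tendsto_eq_intros refl | simp)+
  show "((\<lambda>t. T t s0) \<longlongrightarrow> id_blinfun) (at s0)"
    by (rule LIM_zero_cancel, rule tendsto_norm_zero_cancel, rule tendsto_sandwich[OF _ _ tendsto_const lim])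
       (use K in \<open>auto intro!: eventually_mono[OF ev]\<close>)
  show "((\<lambda>s. T s0 s) \<longlongrightarrow> id_blinfun) (at s0)"
    by (rule LIM_zero_cancel, rule tendsto_norm_zero_cancel, rule tendsto_sandwich[OF _ _ tendsto_const lim])
       (use K in \<open>auto intro!: eventually_mono[OF ev] simp: abs_minus_commute\<close>)
qed

text \<open>Continuity at \<open>(t0, s0)\<close> follows from continuity at the diagonal by the factorization
  \<open>T t s = T t t0 \<circ> T t0 s0 \<circ> T s0 s\<close>.\<close>
lemma T_continuous: "continuous_on UNIV (\<lambda>(t, s). T t s)"
proof -
  have "isCont (\<lambda>p. T (fst p) (snd p)) (t0, s0)" for t0 s0
  proof -
    have c: "isCont (\<lambda>t. T t t0) t0" "isCont (\<lambda>s. T s0 s) s0"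
      using T_tendsto_id by (simp_all add: isCont_def)
    have "isCont (\<lambda>p. T (fst p) t0) (t0, s0)" "isCont (\<lambda>p. T s0 (snd p)) (t0, s0)"
      using isCont_o2[OF isCont_fst[OF continuous_ident], of "(t0, s0)" "\<lambda>t. T t t0"]
        isCont_o2[OF isCont_snd[OF continuous_ident], of "(t0, s0)" "\<lambda>s. T s0 s"] c by auto
    then have "isCont (\<lambda>p. T (fst p) t0 o\<^sub>L (T t0 s0 o\<^sub>L T s0 (snd p))) (t0, s0)"
      by (intro bounded_bilinear.continuous[OF bounded_bilinear_blinfun_compose] continuous_const)
    then show ?thesis by (simp add: T_comp)
  qed
  then show ?thesis
    by (simp add: continuous_on_eq_continuous_at case_prod_beta')
qed

lemma continuous_on_T [continuous_intros]:
  fixes h :: "'c::topological_space \<Rightarrow> real"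
  assumes "continuous_on S h" "continuous_on S k"
  shows "continuous_on S (\<lambda>x. T (h x) (k x))"
  using continuous_on_compose2[OF T_continuous continuous_on_Pair[OF assms]] by simp

text \<open>Both \<open>T t s\<close> and \<open>id + \<integral>\<^sub>s\<^sup>t A r \<circ> T r s dr\<close> take the same value at every vector, and the
  integrand of the latter is continuous in operator norm.\<close>
lemma T_has_vector_derivative: "((\<lambda>t. T t s) has_vector_derivative A t o\<^sub>L T t s) (at t)"
proof -
  let ?G = "\<lambda>r. A r o\<^sub>L T r s"
  have G: "continuous_on UNIV ?G" by (intro continuous_intros A_cont)
  have "T t s = id_blinfun + oint s t ?G" for t
  proof (rule blinfun_eqI)
    fix x
    have "oint s t ?G x = oint s t (\<lambda>r. ?G r x)"
      using oint_bounded_linear[OF blinfun.bounded_linear_left G] by metis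
    also have "\<dots> = T t s x - T s s x"
    proof (rule oint_unique)
      show "continuous_on UNIV (\<lambda>r. ?G r x)" by (intro continuous_intros A_cont)
      show "((\<lambda>t. T t s x) has_vector_derivative ?G t x) (at t)" for t
        using linear_T by (simp add: linear_solution_def)
    qed
    finally show "T t s x = (id_blinfun + oint s t ?G) x"
      by (simp add: blinfun.add_left)
  qed
  then have eq: "(\<lambda>t. T t s) = (\<lambda>t. id_blinfun + oint s t ?G)" by blast
  have "((\<lambda>t. id_blinfun + oint s t ?G) has_vector_derivative ?G t) (at t)"
    using has_vector_derivative_add[OF has_vector_derivative_const oint_has_vector_derivative[OF G]]
    by simp
  then show ?thesis by (simp only: eq[symmetric])
qed

lemma T_local_bound:
  obtains K where "0 < K" "\<And>t s. t \<in> {a..b} \<Longrightarrow> s \<in> {a..b} \<Longrightarrow> norm (T t s) \<le> K"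
proof -
  have "compact ((\<lambda>(t, s). T t s) ` ({a..b} \<times> {a..b}))"
    by (intro compact_continuous_image continuous_on_subset[OF T_continuous] compact_Times) auto
  then obtain K where "\<forall>y \<in> (\<lambda>(t, s). T t s) ` ({a..b} \<times> {a..b}). norm y \<le> K"
    using compact_imp_bounded bounded_iff by metis
  then have "norm (T t s) \<le> K" if "t \<in> {a..b}" "s \<in> {a..b}" for t s
    using that by (auto simp: image_iff split_beta)
  then show ?thesis by (intro that[of "\<bar>K\<bar> + 1"]) force+
qed

lemma mild_solutionI:
  assumes g: "continuous_on UNIV g"
    and v: "\<And>t. v t = T t s (v s) + oint s t (\<lambda>r. T t r (g r))"
  shows "mild_solution T g v"
  unfolding mild_solution_def
proof (intro allI)
  fix a t
  have cont: "continuous_on UNIV (\<lambda>r. T u r (g r))" for u by (intro continuous_intros g)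
  have "T t a (v a) = T t s (v s) + oint s a (\<lambda>r. T t r (g r))"
    using oint_blinfun[OF cont, of s a "T t a" a] by (subst v) (simp add: blinfun.add_right)
  then show "v t = T t a (v a) + oint a t (\<lambda>r. T t r (g r))"
    by (subst v) (simp add: oint_combine[OF cont] add.assoc)
qed

lemma mild_solution_derivative:
  assumes g: "continuous_on UNIV g" and v: "mild_solution T g v"
  shows "(v has_vector_derivative A t (v t) + g t) (at t)"
proof -
  have cont: "continuous_on UNIV (\<lambda>r. T u r (g r))" for u by (intro continuous_intros g)
  have eq: "v t = T t 0 (v 0 + oint 0 t (\<lambda>r. T 0 r (g r)))" for t
    using v[unfolded mild_solution_def, rule_format, of t 0]
      oint_blinfun[OF cont, of 0 t "T t 0" 0] by (simp add: blinfun.add_right)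
  let ?y = "\<lambda>t. v 0 + oint 0 t (\<lambda>r. T 0 r (g r))"
  have y: "(?y has_vector_derivative T 0 t (g t)) (at t)"
    by (auto intro!: derivative_eq_intros oint_has_vector_derivative cont)
  have "((\<lambda>t. T t 0 (?y t)) has_vector_derivative T t 0 (T 0 t (g t)) + (A t o\<^sub>L T t 0) (?y t)) (at t)"
    by (rule bounded_bilinear.has_vector_derivative[OF bounded_bilinear_blinfun_apply T_has_vector_derivative y])
  then show ?thesis by (simp add: eq[symmetric] add.commute)
qed

lemma mild_solution_continuous:
  "continuous_on UNIV g \<Longrightarrow> mild_solution T g v \<Longrightarrow> continuous_on UNIV v"
  using mild_solution_derivative
  by (meson continuous_at_imp_continuous_on has_vector_derivative_continuous)

text \<open>The nontrivial direction is uniqueness: the mild solution with the same value at time \<open>0\<close> differs from \<open>v\<close>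
  by a solution of the linear equation that vanishes at time \<open>0\<close>.\<close>
lemma mild_solution_iff:
  assumes g: "continuous_on UNIV g"
  shows "mild_solution T g v \<longleftrightarrow> (\<forall>t. (v has_vector_derivative A t (v t) + g t) (at t))"
proof
  assume v: "\<forall>t. (v has_vector_derivative A t (v t) + g t) (at t)"
  have cont: "continuous_on UNIV (\<lambda>r. T u r (g r))" for u by (intro continuous_intros g)
  define w where "w t = T t 0 (v 0) + oint 0 t (\<lambda>r. T t r (g r))" for t
  have "w 0 = v 0" by (simp add: w_def)
  then have w: "mild_solution T g w"
    by (intro mild_solutionI[of _ _ 0] g) (simp add: w_def)
  have "linear_solution A (\<lambda>t. v t - w t)"
    unfolding linear_solution_def
  proof
    fix t
    show "((\<lambda>t. v t - w t) has_vector_derivative A t (v t - w t)) (at t)"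
      using has_vector_derivative_diff[OF v[rule_format] mild_solution_derivative[OF g w], of t]
      by (simp add: blinfun.diff_right)
  qed
  then have "v t - w t = T t 0 (v 0 - w 0)" for t
    by (rule linear_solution_eq)
  then have "v = w" using \<open>w 0 = v 0\<close> by auto
  with w show "mild_solution T g v" by simp
qed (use mild_solution_derivative[OF g] in blast)

lemma mild_solution_add:
  assumes "continuous_on UNIV g" "continuous_on UNIV h" "mild_solution T g v" "mild_solution T h w"
  shows "mild_solution T (\<lambda>t. g t + h t) (\<lambda>t. v t + w t)"
proof (rule mild_solutionI[of _ _ 0])
  have "oint 0 t (\<lambda>r. T t r (g r + h r)) = oint 0 t (\<lambda>r. T t r (g r)) + oint 0 t (\<lambda>r. T t r (h r))" for t
    unfolding blinfun.add_right by (intro oint_add continuous_intros assms)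
  then show "v t + w t = T t 0 (v 0 + w 0) + oint 0 t (\<lambda>r. T t r (g r + h r))" for t
    using assms(3,4)[unfolded mild_solution_def, rule_format, of t 0]
    by (simp only: blinfun.add_right) simp
qed (intro continuous_intros assms)

text \<open>With \<open>R\<close> an invariant projection this is the projection of the inhomogeneous equation to
  an invariant family of subspaces.\<close>
lemma mild_solution_commute:
  fixes R :: "real \<Rightarrow> 'a \<Rightarrow>\<^sub>L 'a"
  assumes g: "continuous_on UNIV g" and R: "\<And>t s x. R t (T t s x) = T t s (R s x)"
    and v: "mild_solution T g v"
  shows "mild_solution T (\<lambda>t. R t (g t)) (\<lambda>t. blinfun_apply (R t) (v t))"
  unfolding mild_solution_def
proof (intro allI)
  fix s t
  have "R t (v t) = R t (T t s (v s)) + R t (oint s t (\<lambda>r. T t r (g r)))"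
    using v by (metis mild_solution_def blinfun.add_right)
  also have "R t (oint s t (\<lambda>r. T t r (g r))) = oint s t (\<lambda>r. R t (T t r (g r)))"
    by (rule oint_blinfun[symmetric]) (intro continuous_intros g)
  finally show "R t (v t) = T t s (R s (v s)) + oint s t (\<lambda>r. T t r (R r (g r)))"
    by (simp add: R)
qed

text \<open>Invariance determines the whole family from its value at time \<open>0\<close>, namely
  \<open>R t = T t 0 \<circ> R 0 \<circ> T 0 t\<close>; hence the projections of an invariant splitting are continuous.\<close>
lemma continuous_on_commuting:
  fixes R :: "real \<Rightarrow> 'a \<Rightarrow>\<^sub>L 'a"
  assumes R: "\<And>t s x. R t (T t s x) = T t s (R s x)"
  shows "continuous_on S R"
proof -
  have "R t = T t 0 o\<^sub>L (R 0 o\<^sub>L T 0 t)" for t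
    by (rule blinfun_eqI) (simp add: R[symmetric])
  then have "R = (\<lambda>t. T t 0 o\<^sub>L (R 0 o\<^sub>L T 0 t))" by blast
  moreover have "continuous_on S (\<lambda>t. T t 0 o\<^sub>L (R 0 o\<^sub>L T 0 t))"
    by (intro continuous_intros)
  ultimately show ?thesis by (simp only:)
qed

end

section \<open>Trichotomies and integrals along the transverse directions\<close>

lemma Lip_bound:
  assumes "Lip g < \<infinity>"
  shows "norm (g x - g y) \<le> enn2real (Lip g) * norm (x - y)"
proof (cases "x = y")
  case False
  have "ennreal (norm (g x - g y) / norm (x - y)) \<le> Lip g"
    unfolding Lip_def using False by (intro SUP_upper2[of "(x, y)"]) auto
  also have "\<dots> = ennreal (enn2real (Lip g))" using assms by simp
  finally show ?thesis using False by (simp add: ennreal_le_iff field_simps)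
qed simp

text \<open>Here \<open>\<sigma>\<close> and \<open>\<omega>\<close> are real upper bounds for the two constants of the theorem. The last two
  conditions on \<open>N\<close> say that \<open>\<omega> \<le> N / (1 + N) - \<sigma> * N\<close> and that the right-hand
  side is strictly increasing in \<open>N\<close> up to this point: the inequality keeps the slopes of
  transformed graphs at most \<open>N\<close>, and the monotonicity makes it strong enough for a contraction.\<close>
locale trichotomy = evolution A T
  for A :: "real \<Rightarrow> 'a::banach \<Rightarrow>\<^sub>L 'a" and T +
  fixes P Qp Qm :: "real \<Rightarrow> 'a \<Rightarrow>\<^sub>L 'a" and \<alpha> \<beta>p \<beta>m :: "real \<Rightarrow> real \<Rightarrow> real"
    and f :: "real \<Rightarrow> 'a \<Rightarrow> 'a" and \<sigma> \<omega> N :: real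
  assumes trich: "generalized_trichotomy T P Qp Qm \<alpha> \<beta>p \<beta>m"
    and f_cont: "continuous_on UNIV (\<lambda>(t, x). f t x)"
    and f_zero [simp]: "\<And>t. f t 0 = 0"
    and Lip_finite: "\<And>t. Lip (f t) < \<infinity>"
    and meas: "integrals_defined \<alpha> \<beta>p \<beta>m f"
    and sigma: "sigma_const \<alpha> f \<le> ennreal \<sigma>" "0 \<le> \<sigma>"
    and omega: "omega_const \<alpha> \<beta>p \<beta>m f \<le> ennreal \<omega>" "0 \<le> \<omega>"
    and N: "0 < N" "\<sigma> * (1 + N)\<^sup>2 < 1" "(1 + N) * (\<sigma> * N + \<omega>) \<le> N"
begin

definition L :: "real \<Rightarrow> real" where "L r = enn2real (Lip (f r))"

text \<open>This is the solution of \<open>M = 1 + \<sigma> * (1 + N) * M\<close>, the growth factor of solutions on a graph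
  of slope \<open>N\<close> relative to the weight \<open>\<alpha>\<close>.\<close>
definition M :: real where "M = 1 / (1 - \<sigma> * (1 + N))"

lemma L_nonneg [simp]: "0 \<le> L r"
  by (simp add: L_def)

lemma f_Lip: "norm (f r x - f r y) \<le> L r * norm (x - y)"
  unfolding L_def by (rule Lip_bound[OF Lip_finite])

lemma Lip_eq: "Lip (f r) = ennreal (L r)"
  using Lip_finite[of r] by (simp add: L_def)

lemma sigma_N: "\<sigma> * (1 + N) < 1 / (1 + N)" "\<sigma> * (1 + N) < 1"
proof -
  show *: "\<sigma> * (1 + N) < 1 / (1 + N)"
    using N(1,2) by (simp add: field_simps power2_eq_square)
  have "1 / (1 + N) \<le> 1" using N(1) by simp
  with * show "\<sigma> * (1 + N) < 1" by linarith
qed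

lemma M_ge_1: "1 \<le> M"
  using sigma_N(2) sigma(2) N(1) by (simp add: M_def)

lemma M_eq: "1 + \<sigma> * (1 + N) * M = M"
  using sigma_N(2) by (simp add: M_def field_simps)

lemma omega_M: "\<omega> * (1 + N) * M \<le> N"
proof -
  have "\<omega> * (1 + N) \<le> N * (1 - \<sigma> * (1 + N))"
    using N(3) by (simp add: algebra_simps)
  then show ?thesis using sigma_N(2) by (simp add: M_def pos_divide_le_eq)
qed

lemma contraction: "\<omega> * M\<^sup>2 < 1"
proof -
  have "\<omega> * M \<le> N / (1 + N)" using omega_M N(1) by (simp add: field_simps)
  also have "\<dots> = 1 - 1 / (1 + N)" using N(1) by (simp add: field_simps)
  also have "\<dots> < 1 - \<sigma> * (1 + N)" using sigma_N(1) by simp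
  finally have "\<omega> * M * M < (1 - \<sigma> * (1 + N)) * M" using M_ge_1 by simp
  also have "\<dots> = 1" using sigma_N(2) by (simp add: M_def)
  finally show ?thesis by (simp add: power2_eq_square mult.assoc)
qed

lemma alpha_pos [simp]: "0 < \<alpha> t s" "0 \<le> \<alpha> t s" "\<alpha> t s \<noteq> 0"
proof -
  show "0 < \<alpha> t s" using trich by (simp add: generalized_trichotomy_def)
  then show "0 \<le> \<alpha> t s" "\<alpha> t s \<noteq> 0" by simp_all
qed

lemma T_bounds:
  "norm (T t s (P s x)) \<le> \<alpha> t s * norm x"
  "s \<le> t \<Longrightarrow> norm (T t s (Qp s x)) \<le> \<beta>p t s * norm x"
  "t \<le> s \<Longrightarrow> norm (T t s (Qm s x)) \<le> \<beta>m t s * norm x"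
proof -
  have *: "norm (B x) \<le> b * norm x" if "norm B \<le> b" for B :: "'a \<Rightarrow>\<^sub>L 'a" and b
    using norm_blinfun[of B x] mult_right_mono[OF that, of "norm x"] by simp
  show "norm (T t s (P s x)) \<le> \<alpha> t s * norm x"
    using *[of "T t s o\<^sub>L P s"] trich by (simp add: generalized_trichotomy_def)
  show "s \<le> t \<Longrightarrow> norm (T t s (Qp s x)) \<le> \<beta>p t s * norm x"
    using *[of "T t s o\<^sub>L Qp s"] trich by (simp add: generalized_trichotomy_def)
  show "t \<le> s \<Longrightarrow> norm (T t s (Qm s x)) \<le> \<beta>m t s * norm x"
    using *[of "T t s o\<^sub>L Qm s"] trich by (simp add: generalized_trichotomy_def)
qed

lemma Q_sum: "P t x + Qp t x + Qm t x = x"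
proof -
  have "(P t + Qp t + Qm t) x = x"
    using trich by (simp add: generalized_trichotomy_def invariant_splitting_def)
  then show ?thesis by (simp add: blinfun.add_left)
qed

lemma proj [simp]:
  "P t (P t x) = P t x" "Qp t (Qp t x) = Qp t x" "Qm t (Qm t x) = Qm t x"
  "P t (Qp t x) = 0" "P t (Qm t x) = 0"
proof -
  have sp: "invariant_splitting T P Qp Qm" using trich by (simp add: generalized_trichotomy_def)
  then have "(P t o\<^sub>L P t) x = P t x" "(Qp t o\<^sub>L Qp t) x = Qp t x" "(Qm t o\<^sub>L Qm t) x = Qm t x"
    "(P t o\<^sub>L Qp t) x = 0"
    by (simp_all add: invariant_splitting_def projection_def)
  then show *: "P t (P t x) = P t x" "Qp t (Qp t x) = Qp t x" "Qm t (Qm t x) = Qm t x" "P t (Qp t x) = 0"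
    by simp_all
  show "P t (Qm t x) = 0"
    using Q_sum[of t x, THEN arg_cong[where f = "P t"]] * by (simp add: blinfun.add_right)
qed

lemma commute:
  "P t (T t s x) = T t s (P s x)" "Qp t (T t s x) = T t s (Qp s x)" "Qm t (T t s x) = T t s (Qm s x)"
proof -
  have "(P t o\<^sub>L T t s) x = (T t s o\<^sub>L P s) x" "(Qp t o\<^sub>L T t s) x = (T t s o\<^sub>L Qp s) x"
    using trich by (simp_all add: generalized_trichotomy_def invariant_splitting_def)
  then show *: "P t (T t s x) = T t s (P s x)" "Qp t (T t s x) = T t s (Qp s x)" by simp_all
  have "Qm t (T t s x) = T t s x - P t (T t s x) - Qp t (T t s x)"
    using Q_sum[of t "T t s x"] by (simp add: algebra_simps)
  also have "\<dots> = T t s (Qm s x)"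
    using arg_cong[OF Q_sum[of s x], of "T t s"] * by (simp add: blinfun.add_right algebra_simps)
  finally show "Qm t (T t s x) = T t s (Qm s x)" .
qed

lemma proj_cont: "continuous_on S P" "continuous_on S Qp" "continuous_on S Qm"
  by (rule continuous_on_commuting, rule commute)+

lemma continuous_on_proj [continuous_intros]:
  fixes h :: "'c::topological_space \<Rightarrow> real"
  assumes "continuous_on S h"
  shows "continuous_on S (\<lambda>x. P (h x))" "continuous_on S (\<lambda>x. Qp (h x))" "continuous_on S (\<lambda>x. Qm (h x))"
  by (rule continuous_on_compose2[OF proj_cont(1) assms subset_UNIV]
      continuous_on_compose2[OF proj_cont(2) assms subset_UNIV]
      continuous_on_compose2[OF proj_cont(3) assms subset_UNIV])+

text \<open>What \<open>\<sigma>\<close> is for: integration against \<open>\<alpha> t r * L r\<close> turns a bound \<open>c * \<alpha> r s\<close> in the weight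
  based at \<open>s\<close> into the bound \<open>c * \<sigma> * \<alpha> t s\<close> in the same weight.\<close>
lemma sigma_bound:
  fixes G :: "real \<Rightarrow> real"
  assumes G: "continuous_on UNIV G" "\<And>r. 0 \<le> G r" and "0 \<le> c"
    and le: "\<And>r. r \<in> closed_segment s t \<Longrightarrow> G r \<le> c * (\<alpha> t r * L r * \<alpha> r s)"
  shows "\<bar>oint s t G\<bar> \<le> c * \<sigma> * \<alpha> t s"
proof -
  have "(\<integral>\<^sup>+r\<in>closed_segment s t. sigma_integrand \<alpha> f t s r \<partial>lebesgue) \<le> sigma_const \<alpha> f"
    unfolding sigma_const_def by (rule SUP_upper2[of "(t, s)"]) auto
  then have int: "(\<integral>\<^sup>+r\<in>closed_segment s t. sigma_integrand \<alpha> f t s r \<partial>lebesgue) \<le> ennreal \<sigma>"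
    using sigma(1) by (rule order_trans)
  have "\<bar>oint s t G\<bar> \<le> (c * \<alpha> t s) * \<sigma>"
  proof (rule abs_oint_le_nn_integral[OF G _ _ _ _ _ int sigma(2)])
    show "sigma_integrand \<alpha> f t s \<in> borel_measurable (lebesgue_on (closed_segment s t))"
      using meas by (simp add: integrals_defined_def)
    show "closed_segment s t \<in> sets lebesgue"
      using borel_closed[OF closed_segment] by (rule sets_completionI_sets[of _ lborel, simplified])
    fix r assume r: "r \<in> closed_segment s t"
    have "sigma_integrand \<alpha> f t s r = ennreal (\<alpha> t r * L r * \<alpha> r s / \<alpha> t s)"
      by (simp add: sigma_integrand_def Lip_eq ennreal_mult[symmetric] divide_ennreal)
    then show "ennreal (G r) \<le> ennreal (c * \<alpha> t s) * sigma_integrand \<alpha> f t s r"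
      using le[OF r] \<open>0 \<le> c\<close> by (simp add: ennreal_mult[symmetric] ennreal_leI)
  qed (use \<open>0 \<le> c\<close> in auto)
  then show ?thesis by (simp add: mult_ac)
qed

text \<open>Since \<open>\<omega>\<close> bounds the sum of the two half-line integrals, the bounds \<open>Bp\<close> and \<open>Bm\<close> have to be
  chosen together.\<close>
lemma omega_bound:
  assumes "0 \<le> c"
  obtains Bp Bm where "Bp + Bm \<le> c * \<omega>"
    "\<And>G a. continuous_on UNIV G \<Longrightarrow> (\<And>r. 0 \<le> G r) \<Longrightarrow>
        (\<And>r. r \<le> s \<Longrightarrow> G r \<le> c * (\<beta>p s r * L r * \<alpha> r s)) \<Longrightarrow> a \<le> s \<Longrightarrow> \<bar>oint s a G\<bar> \<le> Bp"
    "\<And>G a. continuous_on UNIV G \<Longrightarrow> (\<And>r. 0 \<le> G r) \<Longrightarrow>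
        (\<And>r. s \<le> r \<Longrightarrow> G r \<le> c * (\<beta>m s r * L r * \<alpha> r s)) \<Longrightarrow> s \<le> a \<Longrightarrow> \<bar>oint s a G\<bar> \<le> Bm"
proof -
  define Ip where "Ip = (\<integral>\<^sup>+r\<in>{..s}. omega_integrand \<alpha> \<beta>p f s r \<partial>lebesgue)"
  define Im where "Im = (\<integral>\<^sup>+r\<in>{s..}. omega_integrand \<alpha> \<beta>m f s r \<partial>lebesgue)"
  have "Ip + Im \<le> omega_const \<alpha> \<beta>p \<beta>m f"
    unfolding omega_const_def Ip_def Im_def by (rule SUP_upper2[of s]) auto
  then have I: "Ip + Im \<le> ennreal \<omega>" using omega(1) by (rule order_trans)
  then have fin: "Ip = ennreal (enn2real Ip)" "Im = ennreal (enn2real Im)"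
    using le_less_trans[OF I ennreal_less_top] by (auto simp: less_top[symmetric])
  with I have "ennreal (enn2real Ip + enn2real Im) \<le> ennreal \<omega>"
    by (subst ennreal_plus) auto
  then have sum: "enn2real Ip + enn2real Im \<le> \<omega>" using omega(2) by (simp only: ennreal_le_iff)
  have pos: "r \<le> s \<Longrightarrow> 0 < \<beta>p s r" "s \<le> r \<Longrightarrow> 0 < \<beta>m s r" for r
    using trich by (auto simp: generalized_trichotomy_def)
  show thesis
  proof (rule that)
    show "c * enn2real Ip + c * enn2real Im \<le> c * \<omega>"
      using mult_left_mono[OF sum assms] by (simp add: distrib_left)
  next
    fix G :: "real \<Rightarrow> real" and a
    assume G: "continuous_on UNIV G" "\<And>r. 0 \<le> G r" and "a \<le> s"
      and le: "\<And>r. r \<le> s \<Longrightarrow> G r \<le> c * (\<beta>p s r * L r * \<alpha> r s)"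
    show "\<bar>oint s a G\<bar> \<le> c * enn2real Ip"
    proof (rule abs_oint_le_nn_integral[OF G, where h = "omega_integrand \<alpha> \<beta>p f s" and S = "{..s}"])
      show "omega_integrand \<alpha> \<beta>p f s \<in> borel_measurable (lebesgue_on {..s})"
        using meas by (simp add: integrals_defined_def)
      fix r assume "r \<in> closed_segment s a"
      then have r: "r \<le> s" using \<open>a \<le> s\<close> by (auto simp: closed_segment_eq_real_ivl split: if_splits)
      have "omega_integrand \<alpha> \<beta>p f s r = ennreal (\<beta>p s r * L r * \<alpha> r s)"
        using pos(1)[OF r] by (simp add: omega_integrand_def Lip_eq ennreal_mult[symmetric] less_imp_le)
      then show "ennreal (G r) \<le> ennreal c * omega_integrand \<alpha> \<beta>p f s r"
        using le[OF r] \<open>0 \<le> c\<close> pos(1)[OF r] by (simp add: ennreal_mult[symmetric] ennreal_leI less_imp_le)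
    qed (use \<open>a \<le> s\<close> assms fin Ip_def in \<open>auto simp: closed_segment_eq_real_ivl split: if_splits\<close>)
  next
    fix G :: "real \<Rightarrow> real" and a
    assume G: "continuous_on UNIV G" "\<And>r. 0 \<le> G r" and "s \<le> a"
      and le: "\<And>r. s \<le> r \<Longrightarrow> G r \<le> c * (\<beta>m s r * L r * \<alpha> r s)"
    show "\<bar>oint s a G\<bar> \<le> c * enn2real Im"
    proof (rule abs_oint_le_nn_integral[OF G, where h = "omega_integrand \<alpha> \<beta>m f s" and S = "{s..}"])
      show "omega_integrand \<alpha> \<beta>m f s \<in> borel_measurable (lebesgue_on {s..})"
        using meas by (simp add: integrals_defined_def)
      fix r assume "r \<in> closed_segment s a"
      then have r: "s \<le> r" using \<open>s \<le> a\<close> by (auto simp: closed_segment_eq_real_ivl split: if_splits)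
      have "omega_integrand \<alpha> \<beta>m f s r = ennreal (\<beta>m s r * L r * \<alpha> r s)"
        using pos(2)[OF r] by (simp add: omega_integrand_def Lip_eq ennreal_mult[symmetric] less_imp_le)
      then show "ennreal (G r) \<le> ennreal c * omega_integrand \<alpha> \<beta>m f s r"
        using le[OF r] \<open>0 \<le> c\<close> pos(2)[OF r] by (simp add: ennreal_mult[symmetric] ennreal_leI less_imp_le)
    qed (use \<open>s \<le> a\<close> assms fin Im_def in \<open>auto simp: closed_segment_eq_real_ivl split: if_splits\<close>)
  qed
qed

text \<open>A forcing term of this size has convergent transverse integrals at every time; it is what a
  solution of growth \<open>\<alpha> r s\<close> produces.\<close>
definition admissible :: "(real \<Rightarrow> 'a) \<Rightarrow> bool" where
  "admissible w \<longleftrightarrow> continuous_on UNIV w \<and> (\<forall>s. \<exists>c\<ge>0. \<forall>r. norm (w r) \<le> c * (L r * \<alpha> r s))"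

text \<open>The part complementary to \<open>P\<close> of a solution of \<open>v' = A t v + w t\<close> whose growth is controlled
  by \<open>\<alpha>\<close>: the \<open>Qp\<close>-component accumulates from the past, the \<open>Qm\<close>-component
  from the future. The first oriented integral runs backwards from \<open>s\<close>, hence its minus sign.\<close>
definition transverse :: "(real \<Rightarrow> 'a) \<Rightarrow> real \<Rightarrow> 'a" where
  "transverse w s = - lim (\<lambda>n. oint s (- real n) (\<lambda>r. T s r (Qp r (w r))))
                    - lim (\<lambda>n. oint s (real n) (\<lambda>r. T s r (Qm r (w r))))"

lemma transverse_limits:
  assumes w: "continuous_on UNIV w" and "0 \<le> c" and le: "\<And>r. norm (w r) \<le> c * (L r * \<alpha> r s)"
  shows "\<exists>lp lm. (\<lambda>n. oint s (- real n) (\<lambda>r. T s r (Qp r (w r)))) \<longlonglongrightarrow> lp \<and>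
     (\<lambda>n. oint s (real n) (\<lambda>r. T s r (Qm r (w r)))) \<longlonglongrightarrow> lm \<and> norm (- lp - lm) \<le> c * \<omega>"
proof -
  obtain Bp Bm where B: "Bp + Bm \<le> c * \<omega>"
    "\<And>G a. continuous_on UNIV G \<Longrightarrow> (\<And>r. 0 \<le> G r) \<Longrightarrow>
        (\<And>r. r \<le> s \<Longrightarrow> G r \<le> c * (\<beta>p s r * L r * \<alpha> r s)) \<Longrightarrow> a \<le> s \<Longrightarrow> \<bar>oint s a G\<bar> \<le> Bp"
    "\<And>G a. continuous_on UNIV G \<Longrightarrow> (\<And>r. 0 \<le> G r) \<Longrightarrow>
        (\<And>r. s \<le> r \<Longrightarrow> G r \<le> c * (\<beta>m s r * L r * \<alpha> r s)) \<Longrightarrow> s \<le> a \<Longrightarrow> \<bar>oint s a G\<bar> \<le> Bm"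
    using omega_bound[OF \<open>0 \<le> c\<close>, of s] by blast
  have pos: "r \<le> s \<Longrightarrow> 0 \<le> \<beta>p s r" "s \<le> r \<Longrightarrow> 0 \<le> \<beta>m s r" for r
    using trich by (auto simp: generalized_trichotomy_def less_imp_le)
  have "\<exists>l. (\<lambda>n. oint s (-1 * real n) (\<lambda>r. T s r (Qp r (w r)))) \<longlonglongrightarrow> l \<and> norm l \<le> Bp"
  proof (rule halfline_limit)
    fix a assume "0 \<le> -1 * (a - s)"
    show "\<bar>oint s a (\<lambda>r. norm (T s r (Qp r (w r))))\<bar> \<le> Bp"
    proof (rule B(2))
      fix r assume r: "r \<le> s"
      have "norm (T s r (Qp r (w r))) \<le> \<beta>p s r * norm (w r)" by (rule T_bounds(2)[OF r])
      also have "\<dots> \<le> \<beta>p s r * (c * (L r * \<alpha> r s))" by (rule mult_left_mono[OF le pos(1)[OF r]])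
      finally show "norm (T s r (Qp r (w r))) \<le> c * (\<beta>p s r * L r * \<alpha> r s)" by (simp add: mult_ac)
    qed (use \<open>0 \<le> -1 * (a - s)\<close> in \<open>auto intro!: continuous_intros w\<close>)
  qed (auto intro!: continuous_intros w)
  moreover have "\<exists>l. (\<lambda>n. oint s (1 * real n) (\<lambda>r. T s r (Qm r (w r)))) \<longlonglongrightarrow> l \<and> norm l \<le> Bm"
  proof (rule halfline_limit)
    fix a assume "0 \<le> 1 * (a - s)"
    show "\<bar>oint s a (\<lambda>r. norm (T s r (Qm r (w r))))\<bar> \<le> Bm"
    proof (rule B(3))
      fix r assume r: "s \<le> r"
      have "norm (T s r (Qm r (w r))) \<le> \<beta>m s r * norm (w r)" by (rule T_bounds(3)[OF r])
      also have "\<dots> \<le> \<beta>m s r * (c * (L r * \<alpha> r s))" by (rule mult_left_mono[OF le pos(2)[OF r]])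
      finally show "norm (T s r (Qm r (w r))) \<le> c * (\<beta>m s r * L r * \<alpha> r s)" by (simp add: mult_ac)
    qed (use \<open>0 \<le> 1 * (a - s)\<close> in \<open>auto intro!: continuous_intros w\<close>)
  qed (auto intro!: continuous_intros w)
  ultimately obtain lp lm where l:
    "(\<lambda>n. oint s (- real n) (\<lambda>r. T s r (Qp r (w r)))) \<longlonglongrightarrow> lp" "norm lp \<le> Bp"
    "(\<lambda>n. oint s (real n) (\<lambda>r. T s r (Qm r (w r)))) \<longlonglongrightarrow> lm" "norm lm \<le> Bm"
    by auto
  have "norm (- lp - lm) \<le> norm lp + norm lm"
    using norm_triangle_ineq4[of "- lp" lm] by simp
  with l B(1) show ?thesis by (meson add_mono order_trans)
qed

lemma transverse_tendsto:
  assumes "admissible w"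
  obtains lp lm where "(\<lambda>n. oint s (- real n) (\<lambda>r. T s r (Qp r (w r)))) \<longlonglongrightarrow> lp"
    "(\<lambda>n. oint s (real n) (\<lambda>r. T s r (Qm r (w r)))) \<longlonglongrightarrow> lm" "transverse w s = - lp - lm"
proof -
  obtain c where c: "0 \<le> c" "\<And>r. norm (w r) \<le> c * (L r * \<alpha> r s)" and w: "continuous_on UNIV w"
    using assms unfolding admissible_def by blast
  then obtain lp lm where l: "(\<lambda>n. oint s (- real n) (\<lambda>r. T s r (Qp r (w r)))) \<longlonglongrightarrow> lp"
    "(\<lambda>n. oint s (real n) (\<lambda>r. T s r (Qm r (w r)))) \<longlonglongrightarrow> lm"
    using transverse_limits[OF w c] by blast
  then show ?thesis by (rule that) (simp only: transverse_def limI[OF l(1)] limI[OF l(2)])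
qed

lemma transverse_diff:
  assumes "admissible w1" "admissible w2" "0 \<le> c"
    and le: "\<And>r. norm (w1 r - w2 r) \<le> c * (L r * \<alpha> r s)"
  shows "norm (transverse w1 s - transverse w2 s) \<le> c * \<omega>"
proof -
  have w: "continuous_on UNIV w1" "continuous_on UNIV w2"
    using assms by (auto simp: admissible_def)
  obtain lp1 lm1 where 1: "(\<lambda>n. oint s (- real n) (\<lambda>r. T s r (Qp r (w1 r)))) \<longlonglongrightarrow> lp1"
    "(\<lambda>n. oint s (real n) (\<lambda>r. T s r (Qm r (w1 r)))) \<longlonglongrightarrow> lm1" "transverse w1 s = - lp1 - lm1"
    using transverse_tendsto[OF assms(1)] .
  obtain lp2 lm2 where 2: "(\<lambda>n. oint s (- real n) (\<lambda>r. T s r (Qp r (w2 r)))) \<longlonglongrightarrow> lp2"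
    "(\<lambda>n. oint s (real n) (\<lambda>r. T s r (Qm r (w2 r)))) \<longlonglongrightarrow> lm2" "transverse w2 s = - lp2 - lm2"
    using transverse_tendsto[OF assms(2)] .
  have "oint s t (\<lambda>r. T s r (Qp r (w1 r - w2 r))) =
      oint s t (\<lambda>r. T s r (Qp r (w1 r))) - oint s t (\<lambda>r. T s r (Qp r (w2 r)))" for t
    unfolding blinfun.diff_right by (intro oint_diff continuous_intros w)
  moreover have "oint s t (\<lambda>r. T s r (Qm r (w1 r - w2 r))) =
      oint s t (\<lambda>r. T s r (Qm r (w1 r))) - oint s t (\<lambda>r. T s r (Qm r (w2 r)))" for t
    unfolding blinfun.diff_right by (intro oint_diff continuous_intros w)
  ultimately have lim: "(\<lambda>n. oint s (- real n) (\<lambda>r. T s r (Qp r (w1 r - w2 r)))) \<longlonglongrightarrow> lp1 - lp2"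
    "(\<lambda>n. oint s (real n) (\<lambda>r. T s r (Qm r (w1 r - w2 r)))) \<longlonglongrightarrow> lm1 - lm2"
    using tendsto_diff[OF 1(1) 2(1)] tendsto_diff[OF 1(2) 2(2)] by simp_all
  have "norm (- (lp1 - lp2) - (lm1 - lm2)) \<le> c * \<omega>"
    using transverse_limits[OF continuous_on_diff[OF w] assms(3) le] lim LIMSEQ_unique by blast
  then show ?thesis by (simp add: 1(3) 2(3) algebra_simps)
qed

lemma transverse_kernel:
  assumes "admissible w"
  shows "P s (transverse w s) = 0"
proof -
  have w: "continuous_on UNIV w" using assms by (simp add: admissible_def)
  obtain lp lm where l: "(\<lambda>n. oint s (- real n) (\<lambda>r. T s r (Qp r (w r)))) \<longlonglongrightarrow> lp"
    "(\<lambda>n. oint s (real n) (\<lambda>r. T s r (Qm r (w r)))) \<longlonglongrightarrow> lm" "transverse w s = - lp - lm"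
    using transverse_tendsto[OF assms] .
  have "P s (oint s t (\<lambda>r. T s r (Qp r (w r)))) = 0" "P s (oint s t (\<lambda>r. T s r (Qm r (w r)))) = 0" for t
    by (subst oint_blinfun[symmetric], intro continuous_intros w, simp add: commute oint_def)+
  then have "P s lp = 0" "P s lm = 0"
    using blinfun.tendsto[OF tendsto_const l(1), of "P s"] blinfun.tendsto[OF tendsto_const l(2), of "P s"]
    by (simp_all add: LIMSEQ_const_iff)
  then show ?thesis by (simp add: l(3) blinfun.diff_right blinfun.minus_right)
qed

text \<open>Changing the base time from \<open>s\<close> to \<open>t\<close> alters each improper integral by an integral over
  the compact interval between them. This gives both invariance of fixed graphs and
  continuity in time of transformed graphs.\<close>
lemma transverse_mild:
  assumes "admissible w"
  shows "mild_solution T (\<lambda>r. w r - P r (w r)) (transverse w)"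
  unfolding mild_solution_def
proof (intro allI)
  fix s t
  have w: "continuous_on UNIV w" using assms by (simp add: admissible_def)
  obtain lp lm where l: "(\<lambda>n. oint s (- real n) (\<lambda>r. T s r (Qp r (w r)))) \<longlonglongrightarrow> lp"
    "(\<lambda>n. oint s (real n) (\<lambda>r. T s r (Qm r (w r)))) \<longlonglongrightarrow> lm" "transverse w s = - lp - lm"
    using transverse_tendsto[OF assms] .
  obtain kp km where k: "(\<lambda>n. oint t (- real n) (\<lambda>r. T t r (Qp r (w r)))) \<longlonglongrightarrow> kp"
    "(\<lambda>n. oint t (real n) (\<lambda>r. T t r (Qm r (w r)))) \<longlonglongrightarrow> km" "transverse w t = - kp - km"
    using transverse_tendsto[OF assms] .
  have shift: "oint t a (\<lambda>r. T t r (g r)) = T t s (oint s a (\<lambda>r. T s r (g r))) - oint s t (\<lambda>r. T t r (g r))"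
    if g: "continuous_on UNIV g" for g a
  proof -
    have c: "continuous_on UNIV (\<lambda>r. T u r (g r))" for u by (intro continuous_intros g)
    show ?thesis
      using oint_combine[OF c, of s t t a] oint_blinfun[OF c, of s a "T t s" s] by (simp add: algebra_simps)
  qed
  have Qc: "continuous_on UNIV (\<lambda>r. Qp r (w r))" "continuous_on UNIV (\<lambda>r. Qm r (w r))"
    by (intro continuous_intros w)+
  have "(\<lambda>n. oint t (- real n) (\<lambda>r. T t r (Qp r (w r)))) \<longlonglongrightarrow> T t s lp - oint s t (\<lambda>r. T t r (Qp r (w r)))"
    unfolding shift[OF Qc(1)] by (intro tendsto_intros l)
  then have kp: "kp = T t s lp - oint s t (\<lambda>r. T t r (Qp r (w r)))" using k(1) LIMSEQ_unique by blast
  have "(\<lambda>n. oint t (real n) (\<lambda>r. T t r (Qm r (w r)))) \<longlonglongrightarrow> T t s lm - oint s t (\<lambda>r. T t r (Qm r (w r)))"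
    unfolding shift[OF Qc(2)] by (intro tendsto_intros l)
  then have km: "km = T t s lm - oint s t (\<lambda>r. T t r (Qm r (w r)))" using k(2) LIMSEQ_unique by blast
  have "w r - P r (w r) = Qp r (w r) + Qm r (w r)" for r
    using Q_sum[of r "w r"] by (simp add: algebra_simps)
  then have "oint s t (\<lambda>r. T t r (w r - P r (w r))) =
     oint s t (\<lambda>r. T t r (Qp r (w r)) + T t r (Qm r (w r)))"
    by (simp add: blinfun.add_right)
  also have "\<dots> = oint s t (\<lambda>r. T t r (Qp r (w r))) + oint s t (\<lambda>r. T t r (Qm r (w r)))"
    by (intro oint_add continuous_intros w)
  finally show "transverse w t = T t s (transverse w s) + oint s t (\<lambda>r. T t r (w r - P r (w r)))"
    by (simp add: l(3) k(3) kp km blinfun.diff_right blinfun.minus_right)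
qed

text \<open>The \<open>Qp\<close>-component satisfies \<open>Qp s (z s) = T s a (Qp a (z a)) + \<integral>\<^sub>a\<^sup>s T s r (Qp r (w r)) dr\<close>, and the
  boundary term is at most \<open>c * \<beta>p s a * \<alpha> a s\<close>, which vanishes as \<open>a\<close> tends to \<open>-\<infinity>\<close>. The
  \<open>Qm\<close>-component is treated in the same way with \<open>a\<close> tending to \<open>+\<infinity>\<close>.\<close>
lemma transverse_unique:
  assumes w: "admissible w" and z: "mild_solution T w z"
    and le: "\<And>r. norm (z r) \<le> c * \<alpha> r s"
    and lim: "((\<lambda>r. \<beta>m s r * \<alpha> r s) \<longlongrightarrow> 0) at_top" "((\<lambda>r. \<beta>p s r * \<alpha> r s) \<longlongrightarrow> 0) at_bot"
  shows "z s - P s (z s) = transverse w s"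
proof -
  have wc: "continuous_on UNIV w" using w by (simp add: admissible_def)
  obtain lp lm where l: "(\<lambda>n. oint s (- real n) (\<lambda>r. T s r (Qp r (w r)))) \<longlonglongrightarrow> lp"
    "(\<lambda>n. oint s (real n) (\<lambda>r. T s r (Qm r (w r)))) \<longlonglongrightarrow> lm" "transverse w s = - lp - lm"
    using transverse_tendsto[OF w] .
  have c: "0 \<le> c" using le[of 0] norm_ge_zero[of "z 0"] alpha_pos(1)[of 0 s]
    by (metis order_trans zero_le_mult_iff not_less)
  have eq: "R s (z s) = T s a (R a (z a)) - oint s a (\<lambda>r. T s r (R r (w r)))"
    if R: "\<And>t s x. R t (T t s x) = T t s (R s x)" for R :: "real \<Rightarrow> 'a \<Rightarrow>\<^sub>L 'a" and a
  proof -
    have Rc: "continuous_on UNIV (\<lambda>r. R r (w r))"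
      by (intro continuous_intros wc continuous_on_commuting[OF R])
    moreover have "continuous_on UNIV (\<lambda>r. T s r (R r (w r)))"
      by (intro continuous_intros wc continuous_on_commuting[OF R])
    ultimately show ?thesis
      using mild_solution_commute[OF wc R z] oint_swap[of "\<lambda>r. T s r (R r (w r))" s a]
      unfolding mild_solution_def by simp
  qed
  have bnd: "s \<ge> r \<Longrightarrow> norm (T s r (Qp r (z r))) \<le> c * (\<beta>p s r * \<alpha> r s)"
            "s \<le> r \<Longrightarrow> norm (T s r (Qm r (z r))) \<le> c * (\<beta>m s r * \<alpha> r s)" for r
  proof -
    have pos: "r \<le> s \<Longrightarrow> 0 \<le> \<beta>p s r" "s \<le> r \<Longrightarrow> 0 \<le> \<beta>m s r"
      using trich by (auto simp: generalized_trichotomy_def less_imp_le)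
    show "s \<ge> r \<Longrightarrow> norm (T s r (Qp r (z r))) \<le> c * (\<beta>p s r * \<alpha> r s)"
      using order_trans[OF T_bounds(2) mult_left_mono[OF le pos(1)]] by (simp add: mult_ac)
    show "s \<le> r \<Longrightarrow> norm (T s r (Qm r (z r))) \<le> c * (\<beta>m s r * \<alpha> r s)"
      using order_trans[OF T_bounds(3) mult_left_mono[OF le pos(2)]] by (simp add: mult_ac)
  qed
  have "((\<lambda>r. T s r (Qp r (z r))) \<longlongrightarrow> 0) at_bot"
  proof (rule Lim_null_comparison[OF _ tendsto_mult_right_zero[OF lim(2), of c]])
    show "\<forall>\<^sub>F r in at_bot. norm (T s r (Qp r (z r))) \<le> c * (\<beta>p s r * \<alpha> r s)"
      using eventually_le_at_bot[of s] by eventually_elim (rule bnd)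
  qed
  moreover have "filterlim (\<lambda>n. - real n) at_bot sequentially"
    using filterlim_real_sequentially by (simp add: filterlim_uminus_at_bot)
  ultimately have "(\<lambda>n. T s (- real n) (Qp (- real n) (z (- real n)))) \<longlonglongrightarrow> 0"
    by (rule filterlim_compose)
  from tendsto_diff[OF this l(1)] have "Qp s (z s) = - lp"
    using eq[OF commute(2)] by (simp add: LIMSEQ_const_iff)
  have "((\<lambda>r. T s r (Qm r (z r))) \<longlongrightarrow> 0) at_top"
  proof (rule Lim_null_comparison[OF _ tendsto_mult_right_zero[OF lim(1), of c]])
    show "\<forall>\<^sub>F r in at_top. norm (T s r (Qm r (z r))) \<le> c * (\<beta>m s r * \<alpha> r s)"
      using eventually_ge_at_top[of s] by eventually_elim (rule bnd)
  qed
  then have "(\<lambda>n. T s (real n) (Qm (real n) (z (real n)))) \<longlonglongrightarrow> 0"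
    using filterlim_real_sequentially by (rule filterlim_compose)
  from tendsto_diff[OF this l(2)] have "Qm s (z s) = - lm"
    using eq[OF commute(3)] by (simp add: LIMSEQ_const_iff)
  moreover have "z s - P s (z s) = Qp s (z s) + Qm s (z s)"
    using Q_sum[of s "z s"] by (simp add: algebra_simps)
  ultimately show ?thesis
    using \<open>Qp s (z s) = - lp\<close> l(3) by simp
qed

end

section \<open>The equation induced on the central spaces by a graph\<close>

context trichotomy
begin

text \<open>Total functions stand for functions on the central spaces: the Lipschitz condition forces
  \<open>p t x = p t (P t x)\<close>. Continuity is then continuity on a product space.\<close>
definition lip_graphs :: "(real \<Rightarrow> 'a \<Rightarrow> 'a) set" where
  "lip_graphs = {p. continuous_on UNIV (\<lambda>(t, x). p t x) \<and> (\<forall>t. p t 0 = 0) \<and>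
     (\<forall>t x. P t (p t x) = 0) \<and> (\<forall>t x y. norm (p t x - p t y) \<le> N * norm (P t x - P t y))}"

definition on_graph :: "(real \<Rightarrow> 'a \<Rightarrow> 'a) \<Rightarrow> (real \<Rightarrow> 'a) \<Rightarrow> real \<Rightarrow> 'a" where
  "on_graph p x r = f r (x r + p r (x r))"

definition reduced_solution :: "(real \<Rightarrow> 'a \<Rightarrow> 'a) \<Rightarrow> (real \<Rightarrow> 'a) \<Rightarrow> bool" where
  "reduced_solution p x \<longleftrightarrow> continuous_on UNIV x \<and> (\<forall>t. P t (x t) = x t) \<and>
     mild_solution T (\<lambda>r. P r (on_graph p x r)) x"

lemma lip_graphsD:
  assumes "p \<in> lip_graphs"
  shows "continuous_on UNIV (\<lambda>(t, x). p t x)" "p t 0 = 0" "P t (p t x) = 0"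
    "norm (p t x - p t y) \<le> N * norm (P t x - P t y)" "p t (P t x) = p t x"
proof -
  show *: "continuous_on UNIV (\<lambda>(t, x). p t x)" "p t 0 = 0" "P t (p t x) = 0"
    "norm (p t x - p t y) \<le> N * norm (P t x - P t y)" for x y
    using assms by (auto simp: lip_graphs_def)
  show "p t (P t x) = p t x" using *(4)[of "P t x" x] by simp
qed

lemma on_graph_cont:
  assumes "p \<in> lip_graphs" "continuous_on UNIV x"
  shows "continuous_on UNIV (on_graph p x)"
proof -
  have "continuous_on UNIV (\<lambda>r. p r (x r))"
    using continuous_on_compose2[OF lip_graphsD(1)[OF assms(1)] continuous_on_Pair[OF continuous_on_id assms(2)]]
    by simp
  then have "continuous_on UNIV (\<lambda>r. x r + p r (x r))" by (intro continuous_intros assms(2))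
  from continuous_on_compose2[OF f_cont continuous_on_Pair[OF continuous_on_id this]]
  show ?thesis by (simp add: on_graph_def[abs_def])
qed

text \<open>Replacing \<open>p\<close> by \<open>q\<close> and \<open>x\<close> by \<open>y\<close> at the same time costs the slope factor \<open>1 + N\<close> on the distance
  of \<open>x\<close> and \<open>y\<close>, plus the distance \<open>d\<close> of the two graphs over the point \<open>y r\<close>.\<close>
lemma on_graph_diff:
  assumes p: "p \<in> lip_graphs" and x: "P r (x r) = x r" "P r (y r) = y r"
    and pq: "norm (p r (y r) - q r (y r)) \<le> d"
  shows "norm (on_graph p x r - on_graph q y r) \<le> L r * ((1 + N) * norm (x r - y r) + d)"
proof -
  have "norm (on_graph p x r - on_graph q y r) \<le> L r * norm ((x r + p r (x r)) - (y r + q r (y r)))"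
    unfolding on_graph_def by (rule f_Lip)
  also have "norm ((x r + p r (x r)) - (y r + q r (y r)))
     = norm ((x r - y r) + (p r (x r) - p r (y r)) + (p r (y r) - q r (y r)))"
    by (simp add: algebra_simps)
  also have "\<dots> \<le> norm (x r - y r) + norm (p r (x r) - p r (y r)) + norm (p r (y r) - q r (y r))"
    by (intro order_trans[OF norm_triangle_ineq] add_mono norm_triangle_ineq order_refl)
  also have "\<dots> \<le> norm (x r - y r) + N * norm (x r - y r) + d"
    using lip_graphsD(4)[OF p, of r "x r" "y r"] pq x by (intro add_mono) auto
  finally show ?thesis by (simp add: mult_left_mono[OF _ L_nonneg] distrib_right)
qed

lemma zero_reduced: "p \<in> lip_graphs \<Longrightarrow> reduced_solution p (\<lambda>_. 0)"
  by (simp add: reduced_solution_def mild_solution_def on_graph_def lip_graphsD oint_def)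

text \<open>No regularity of \<open>\<alpha>\<close> is available, but \<open>\<alpha> r s\<close> dominates the norm of \<open>T r s \<circ> P s\<close>, which is continuous in \<open>r\<close>
  and never zero unless all central spaces are trivial.\<close>
lemma alpha_lower_bound:
  assumes "P 0 \<noteq> 0"
  obtains c where "0 < c" "\<And>r. r \<in> closed_segment s t \<Longrightarrow> c \<le> \<alpha> r s"
proof -
  have nz: "T r s o\<^sub>L P s \<noteq> 0" for r
  proof
    assume 0: "T r s o\<^sub>L P s = 0"
    have "P 0 x = 0" for x
    proof -
      have "P 0 x = P 0 (T 0 r (T r 0 x))" by simp
      also have "\<dots> = T 0 r ((T r s o\<^sub>L P s) (T s 0 x))"
        by (simp add: commute)
      also have "\<dots> = 0" by (simp add: 0)
      finally show ?thesis .
    qed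
    with assms show False by (simp add: blinfun_eqI)
  qed
  have "continuous_on (closed_segment s t) (\<lambda>r. norm (T r s o\<^sub>L P s))"
    by (intro continuous_intros)
  then obtain u where u: "\<And>r. r \<in> closed_segment s t \<Longrightarrow> norm (T u s o\<^sub>L P s) \<le> norm (T r s o\<^sub>L P s)"
    using continuous_attains_inf[of "closed_segment s t"] by (metis compact_segment ends_in_segment(1) empty_iff)
  show ?thesis
  proof (rule that)
    show "0 < norm (T u s o\<^sub>L P s)" using nz by simp
    show "norm (T u s o\<^sub>L P s) \<le> \<alpha> r s" if "r \<in> closed_segment s t" for r
      using u[OF that] trich by (auto simp: generalized_trichotomy_def intro: order_trans)
  qed
qed

text \<open>Let \<open>D\<close> be the supremum of \<open>\<parallel>x r\<parallel> / \<alpha> r s\<close> over the segment from \<open>s\<close> to \<open>t\<close>. It is finite, because \<open>x\<close> is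
  bounded and \<open>\<alpha>\<close> is bounded below there, so the self-estimate
  \<open>D \<le> \<parallel>x s\<parallel> + \<sigma> * ((1 + N) * D + E)\<close> from the integral equation can be solved for \<open>D\<close>.\<close>
lemma weighted_gronwall:
  assumes P0: "P 0 \<noteq> 0"
    and x: "continuous_on UNIV x" "\<And>t. P t (x t) = x t" and w: "continuous_on UNIV w"
    and mild: "mild_solution T (\<lambda>r. P r (w r)) x"
    and E: "0 \<le> E" and le: "\<And>r. norm (w r) \<le> L r * ((1 + N) * norm (x r) + E * \<alpha> r s)"
  shows "norm (x t) \<le> M * (norm (x s) + \<sigma> * E) * \<alpha> t s"
proof -
  let ?J = "closed_segment s t"
  obtain c where c: "0 < c" "\<And>r. r \<in> ?J \<Longrightarrow> c \<le> \<alpha> r s"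
    using alpha_lower_bound[OF P0, of s t] by blast
  have "continuous_on ?J (\<lambda>r. norm (x r))"
    by (intro continuous_on_norm continuous_on_subset[OF x(1)]) auto
  then obtain u where u: "\<And>r. r \<in> ?J \<Longrightarrow> norm (x r) \<le> norm (x u)"
    using continuous_attains_sup[of ?J] by (metis compact_segment ends_in_segment(1) empty_iff)
  define D where "D = (SUP r\<in>?J. norm (x r) / \<alpha> r s)"
  have bdd: "bdd_above ((\<lambda>r. norm (x r) / \<alpha> r s) ` ?J)"
    using u c by (intro bdd_aboveI[of _ "norm (x u) / c"]) (auto intro!: frac_le)
  have D: "norm (x r) \<le> D * \<alpha> r s" if "r \<in> ?J" for r
  proof -
    have "norm (x r) / \<alpha> r s \<le> D" unfolding D_def by (rule cSUP_upper[OF that bdd])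
    then show ?thesis by (simp add: pos_divide_le_eq)
  qed
  have "0 \<le> D * \<alpha> s s" using D[of s] norm_ge_zero order_trans by (metis ends_in_segment(1))
  then have D0: "0 \<le> D" using alpha_pos(1)[of s s] by (simp add: zero_le_mult_iff)
  have "norm (x r) / \<alpha> r s \<le> norm (x s) + \<sigma> * ((1 + N) * D + E)" if r: "r \<in> ?J" for r
  proof -
    have sub: "closed_segment s r \<subseteq> ?J" using r by (simp add: subset_closed_segment)
    have "x r = T r s (P s (x s)) + oint s r (\<lambda>u. T r u (P u (w u)))"
      using mild x(2) unfolding mild_solution_def by metis
    then have "norm (x r) \<le> norm (T r s (P s (x s))) + norm (oint s r (\<lambda>u. T r u (P u (w u))))"
      by (metis norm_triangle_ineq)
    also have "norm (oint s r (\<lambda>u. T r u (P u (w u)))) \<le> \<bar>oint s r (\<lambda>u. norm (T r u (P u (w u))))\<bar>"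
      by (rule norm_oint_le_oint) (auto intro!: continuous_intros w)
    also have "\<dots> \<le> ((1 + N) * D + E) * \<sigma> * \<alpha> r s"
    proof (rule sigma_bound)
      fix u assume u: "u \<in> closed_segment s r"
      have "norm (T r u (P u (w u))) \<le> \<alpha> r u * norm (w u)" by (rule T_bounds(1))
      also have "\<dots> \<le> \<alpha> r u * (L u * ((1 + N) * norm (x u) + E * \<alpha> u s))"
        by (intro mult_left_mono le) simp
      also have "\<dots> \<le> \<alpha> r u * (L u * ((1 + N) * (D * \<alpha> u s) + E * \<alpha> u s))"
        using D[of u] sub u N(1) by (intro mult_left_mono add_right_mono) auto
      finally show "norm (T r u (P u (w u))) \<le> ((1 + N) * D + E) * (\<alpha> r u * L u * \<alpha> u s)"
        by (simp add: algebra_simps)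
    qed (use D0 N E in \<open>auto intro!: continuous_intros w add_nonneg_nonneg mult_nonneg_nonneg\<close>)
    also have "norm (T r s (P s (x s))) \<le> \<alpha> r s * norm (x s)" by (rule T_bounds(1))
    finally show ?thesis by (simp add: pos_divide_le_eq algebra_simps)
  qed
  then have "D \<le> norm (x s) + \<sigma> * ((1 + N) * D + E)"
    unfolding D_def by (intro cSUP_least) auto
  then have "D * (1 - \<sigma> * (1 + N)) \<le> norm (x s) + \<sigma> * E"
    by (simp add: algebra_simps)
  then have "D \<le> M * (norm (x s) + \<sigma> * E)"
    using sigma_N(2) by (simp add: M_def pos_le_divide_eq)
  then have "D * \<alpha> t s \<le> M * (norm (x s) + \<sigma> * E) * \<alpha> t s" by (intro mult_right_mono) auto
  moreover have "norm (x t) \<le> D * \<alpha> t s" by (rule D) simp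
  ultimately show ?thesis by linarith
qed

text \<open>The difference \<open>x - y\<close> solves a linear equation whose forcing term is
  controlled by \<open>x - y\<close> itself and by the distance of the two graphs along \<open>y\<close>.\<close>
lemma reduced_diff:
  assumes P0: "P 0 \<noteq> 0" and p: "p \<in> lip_graphs" "q \<in> lip_graphs"
    and x: "reduced_solution p x" and y: "reduced_solution q y"
    and E: "0 \<le> E" "\<And>r. norm (p r (y r) - q r (y r)) \<le> E * \<alpha> r s"
  shows "norm (x t - y t) \<le> M * (norm (x s - y s) + \<sigma> * E) * \<alpha> t s"
proof -
  have xy: "continuous_on UNIV x" "continuous_on UNIV y" "\<And>t. P t (x t) = x t" "\<And>t. P t (y t) = y t"
    using x y by (auto simp: reduced_solution_def)
  have w: "continuous_on UNIV (on_graph p x)" "continuous_on UNIV (on_graph q y)"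
    using p xy by (auto intro: on_graph_cont)
  have "mild_solution T (\<lambda>r. (- 1 *\<^sub>R id_blinfun) (P r (on_graph q y r))) (\<lambda>t. (- 1 *\<^sub>R id_blinfun) (y t))"
  proof (rule mild_solution_commute)
    show "continuous_on UNIV (\<lambda>r. P r (on_graph q y r))" by (intro continuous_intros w)
  qed (use y in \<open>auto simp: reduced_solution_def blinfun.bilinear_simps\<close>)
  then have "mild_solution T (\<lambda>r. P r (on_graph p x r) + (- 1 *\<^sub>R id_blinfun) (P r (on_graph q y r))) (\<lambda>t. x t + (- 1 *\<^sub>R id_blinfun) (y t))"
    using x w by (intro mild_solution_add continuous_intros) (auto simp: reduced_solution_def)
  then have mild: "mild_solution T (\<lambda>r. P r (on_graph p x r - on_graph q y r)) (\<lambda>t. x t - y t)"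
    by (simp add: blinfun.bilinear_simps)
  show ?thesis
  proof (rule weighted_gronwall[OF P0 _ _ _ mild E(1)])
    show "norm (on_graph p x r - on_graph q y r) \<le> L r * ((1 + N) * norm (x r - y r) + E * \<alpha> r s)" for r
      by (rule on_graph_diff[where p = p and q = q and r = r and x = x and y = y, OF p(1) xy(3,4) E(2)])
  qed (use xy w in \<open>auto intro!: continuous_intros simp: blinfun.diff_right\<close>)
qed

lemma reduced_lipschitz:
  assumes "P 0 \<noteq> 0" "p \<in> lip_graphs" "reduced_solution p x" "reduced_solution p y"
  shows "norm (x t - y t) \<le> M * norm (x s - y s) * \<alpha> t s"
  using reduced_diff[OF assms(1,2,2,3,4), of 0 s t] by simp

lemma reduced_growth:
  assumes "P 0 \<noteq> 0" "p \<in> lip_graphs" "reduced_solution p x"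
  shows "norm (x t) \<le> M * norm (x s) * \<alpha> t s"
  using reduced_lipschitz[OF assms zero_reduced[OF assms(2)]] by simp

text \<open>Picard iteration. The weighted bound \<open>c * k ^ n * \<alpha> t s\<close> for the increments, with
  \<open>k = \<sigma> * (1 + N) < 1\<close>, gives pointwise convergence and passes to the limit in the integral equation. It need
  not be locally uniform in \<open>t\<close>, because \<open>\<alpha>\<close> may be locally unbounded. Applying the
  integral operator once more repairs this: \<open>T t r = T t b \<circ> T b r\<close> and \<open>T t b\<close> is bounded for \<open>t\<close> between \<open>s\<close>
  and \<open>b\<close>, so the increments on the whole segment are controlled by the weight \<open>\<alpha> b s\<close> at its end.\<close>
lemma reduced_exists:
  assumes p: "p \<in> lip_graphs" and \<xi>: "P s \<xi> = \<xi>"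
  shows "\<exists>x. reduced_solution p x \<and> x s = \<xi>"
proof -
  define \<Gamma> where "\<Gamma> x t = T t s \<xi> + oint s t (\<lambda>r. T t r (P r (on_graph p x r)))" for x :: "real \<Rightarrow> 'a" and t
  define ok where "ok x \<longleftrightarrow> continuous_on UNIV x \<and> (\<forall>t. P t (x t) = x t)" for x
  let ?k = "\<sigma> * (1 + N)"
  have k: "0 \<le> ?k" "?k < 1" using sigma_N(2) sigma(2) N(1) by auto
  have cont: "continuous_on UNIV (\<lambda>r. T u r (P r (on_graph p x r)))" "continuous_on UNIV (\<lambda>r. P r (on_graph p x r))"
    if "ok x" for u x
    using that p by (auto intro!: continuous_intros on_graph_cont simp: ok_def)
  have \<Gamma>_mild: "mild_solution T (\<lambda>r. P r (on_graph p x r)) (\<Gamma> x)" if "ok x" for x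
    by (rule mild_solutionI[of _ _ s]) (use cont[OF that] in \<open>simp_all add: \<Gamma>_def\<close>)
  have \<Gamma>_ok: "ok (\<Gamma> x)" if "ok x" for x
    unfolding ok_def
  proof (intro conjI allI)
    show "continuous_on UNIV (\<Gamma> x)"
      by (rule mild_solution_continuous[OF cont(2)[OF that] \<Gamma>_mild[OF that]])
    show "P t (\<Gamma> x t) = \<Gamma> x t" for t
      by (simp add: \<Gamma>_def blinfun.add_right commute \<xi> oint_blinfun[OF cont(1)[OF that], symmetric])
  qed
  have diff: "\<Gamma> x t - \<Gamma> y t = oint s t (\<lambda>r. T t r (P r (on_graph p x r - on_graph p y r)))"
    if "ok x" "ok y" for x y t
    using oint_diff[OF cont(1)[OF that(1)] cont(1)[OF that(2)]] by (simp add: \<Gamma>_def blinfun.diff_right)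
  have integral_bound: "\<bar>oint s b (\<lambda>r. norm (T b r (P r (on_graph p x r - on_graph p y r))))\<bar> \<le> ?k * D * \<alpha> b s"
    if "ok x" "ok y" and D: "0 \<le> D" "\<And>r. norm (x r - y r) \<le> D * \<alpha> r s" for x y b D
  proof -
    have "\<bar>oint s b (\<lambda>r. norm (T b r (P r (on_graph p x r - on_graph p y r))))\<bar> \<le> ((1 + N) * D) * \<sigma> * \<alpha> b s"
    proof (rule sigma_bound)
      fix r
      have "norm (T b r (P r (on_graph p x r - on_graph p y r))) \<le> \<alpha> b r * norm (on_graph p x r - on_graph p y r)"
        by (rule T_bounds(1))
      also have "\<dots> \<le> \<alpha> b r * (L r * ((1 + N) * norm (x r - y r) + 0))"
        using that(1,2) by (intro mult_left_mono on_graph_diff[OF p]) (auto simp: ok_def)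
      also have "\<dots> \<le> \<alpha> b r * (L r * ((1 + N) * (D * \<alpha> r s) + 0))"
        using N(1) by (intro mult_left_mono add_right_mono D(2)) auto
      finally show "norm (T b r (P r (on_graph p x r - on_graph p y r))) \<le> (1 + N) * D * (\<alpha> b r * L r * \<alpha> r s)"
        by (simp add: algebra_simps)
    qed (use D(1) N(1) that(1,2) p in \<open>auto intro!: continuous_intros on_graph_cont simp: ok_def\<close>)
    then show ?thesis by (simp add: mult_ac)
  qed
  have step: "norm (\<Gamma> x t - \<Gamma> y t) \<le> ?k * D * \<alpha> t s"
    if "ok x" "ok y" and D: "0 \<le> D" "\<And>r. norm (x r - y r) \<le> D * \<alpha> r s" for x y t D
  proof -
    have "norm (\<Gamma> x t - \<Gamma> y t) \<le> \<bar>oint s t (\<lambda>r. norm (T t r (P r (on_graph p x r - on_graph p y r))))\<bar>"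
      unfolding diff[OF that(1,2)]
      by (rule norm_oint_le_oint) (use that(1,2) p in \<open>auto intro!: continuous_intros on_graph_cont simp: ok_def\<close>)
    also have "\<dots> \<le> ?k * D * \<alpha> t s" by (rule integral_bound[OF that])
    finally show ?thesis .
  qed
  \<comment> \<open>The iteration starts with \<open>\<Gamma> 0 = T t s \<xi>\<close>, which is bounded by a multiple of \<open>\<alpha> t s\<close>.\<close>
  define u where "u n = (\<Gamma> ^^ Suc n) (\<lambda>_. 0)" for n
  have ok0: "ok (\<lambda>_. 0)" by (simp add: ok_def)
  have u_Suc: "u (Suc n) = \<Gamma> (u n)" for n by (simp add: u_def)
  have u0: "u 0 t = T t s \<xi>" for t
    using p by (simp add: u_def \<Gamma>_def on_graph_def lip_graphsD oint_def)
  have u_ok: "ok (u n)" for n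
    by (induction n) (use \<Gamma>_ok ok0 in \<open>auto simp: u_def\<close>)
  define c where "c = ?k * norm \<xi>"
  have c: "0 \<le> c" using k by (simp add: c_def)
  have inc: "norm (u (Suc n) t - u n t) \<le> c * ?k ^ n * \<alpha> t s" for n t
  proof (induction n arbitrary: t)
    case 0
    have "u 0 = \<Gamma> (\<lambda>_. 0)" by (simp add: u_def)
    then have "norm (u (Suc 0) t - u 0 t) = norm (\<Gamma> (u 0) t - \<Gamma> (\<lambda>_. 0) t)" by (simp only: u_Suc)
    also have "\<dots> \<le> ?k * norm \<xi> * \<alpha> t s"
    proof (rule step[OF u_ok ok0])
      show "norm (u 0 r - 0) \<le> norm \<xi> * \<alpha> r s" for r
        using T_bounds(1)[of r s \<xi>] \<xi> by (simp add: u0 mult.commute)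
    qed simp
    finally show ?case by (simp add: c_def)
  next
    case (Suc n)
    have "norm (\<Gamma> (u (Suc n)) t - \<Gamma> (u n) t) \<le> ?k * (c * ?k ^ n) * \<alpha> t s"
      using Suc c k by (intro step u_ok) auto
    then show ?case by (simp add: u_Suc mult_ac)
  qed
  have inc': "norm (u (Suc n) t - u n t) \<le> (c * \<alpha> t s) * ?k ^ n" for n t
    using inc[of n t] by (simp add: mult_ac)
  define x where "x t = lim (\<lambda>n. u n t)" for t
  have lim: "(\<lambda>n. u n t) \<longlonglongrightarrow> x t" for t
    unfolding x_def convergent_LIMSEQ_iff[symmetric]
    by (rule geometric_increments_convergent[of "\<lambda>n. u n t" "c * \<alpha> t s", OF inc' k])
  have tail: "norm (u n t - x t) \<le> c / (1 - ?k) * ?k ^ n * \<alpha> t s" for n t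
    using geometric_increments_tail[OF inc' k lim, of n t] by (simp add: mult_ac)
  have zero: "(\<lambda>n. a * ?k ^ n) \<longlonglongrightarrow> 0" for a :: real
    using k by (intro tendsto_mult_right_zero LIMSEQ_realpow_zero) auto
  have local_tail: "\<exists>C\<ge>0. \<forall>n. \<forall>t\<in>closed_segment s b. norm (u (Suc n) t - x t) \<le> C * ?k ^ n" for b
  proof -
    obtain K where K: "0 < K" "\<And>t r. t \<in> {min s b..max s b} \<Longrightarrow> r \<in> {min s b..max s b} \<Longrightarrow> norm (T t r) \<le> K"
      using T_local_bound[of "min s b" "max s b"] by blast
    define C where "C = K * (c * \<alpha> b s)"
    have C: "0 \<le> C" using K(1) c by (simp add: C_def)
    have "norm (u (Suc (Suc n)) t - u (Suc n) t) \<le> C * ?k ^ n" if t: "t \<in> closed_segment s b" for n t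
    proof -
      let ?d = "\<lambda>r. on_graph p (u (Suc n)) r - on_graph p (u n) r"
      have d: "continuous_on UNIV ?d"
        using u_ok p by (intro continuous_intros on_graph_cont) (auto simp: ok_def)
      have "norm (oint s t (\<lambda>r. T t r (P r (?d r)))) \<le> \<bar>oint s b (\<lambda>r. K * norm (T b r (P r (?d r))))\<bar>"
      proof (rule norm_oint_le_oint)
        fix r
        have "T t r (P r (?d r)) = T t b (T b r (P r (?d r)))" by simp
        also have "norm \<dots> \<le> norm (T t b) * norm (T b r (P r (?d r)))" by (rule norm_blinfun)
        also have "\<dots> \<le> K * norm (T b r (P r (?d r)))"
          using t by (intro mult_right_mono K(2)) (auto simp: closed_segment_eq_real_ivl split: if_splits)
        finally show "norm (T t r (P r (?d r))) \<le> K * norm (T b r (P r (?d r)))" .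
      qed (use t K(1) in \<open>auto intro!: continuous_intros d\<close>)
      also have "\<dots> = K * \<bar>oint s b (\<lambda>r. norm (T b r (P r (?d r))))\<bar>"
      proof -
        have "oint s b (\<lambda>r. K * norm (T b r (P r (?d r)))) = K * oint s b (\<lambda>r. norm (T b r (P r (?d r))))"
          by (intro oint_bounded_linear bounded_linear_mult_right continuous_intros d)
        then show ?thesis using K(1) by (simp add: abs_mult)
      qed
      also have "\<dots> \<le> K * (?k * (c * ?k ^ n) * \<alpha> b s)"
        using K(1) inc c k by (intro mult_left_mono integral_bound u_ok) auto
      also have "\<dots> = ?k * (C * ?k ^ n)" by (simp only: C_def mult_ac)
      also have "\<dots> \<le> C * ?k ^ n" using k C by (intro mult_left_le_one_le) auto
      finally have "norm (oint s t (\<lambda>r. T t r (P r (?d r)))) \<le> C * ?k ^ n" .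
      moreover have "u (Suc (Suc n)) t - u (Suc n) t = oint s t (\<lambda>r. T t r (P r (?d r)))"
        using diff[OF u_ok u_ok, of "Suc n" t n] by (simp only: u_Suc)
      ultimately show ?thesis by (simp only:)
    qed
    from geometric_increments_tail[OF this k LIMSEQ_Suc[OF lim]]
    have "\<forall>n. \<forall>t\<in>closed_segment s b. norm (u (Suc n) t - x t) \<le> C / (1 - ?k) * ?k ^ n" by blast
    then show ?thesis using C k by (intro exI[of _ "C / (1 - ?k)"]) auto
  qed
  have cont_x: "continuous_on UNIV x"
  proof (rule continuous_at_imp_continuous_on, rule ballI)
    fix t
    define R where "R = \<bar>t - s\<bar> + 1"
    have "0 < R" by (simp add: R_def)
    obtain C1 C2 where C: "\<forall>n. \<forall>t\<in>closed_segment s (s - R). norm (u (Suc n) t - x t) \<le> C1 * ?k ^ n"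
      "\<forall>n. \<forall>t\<in>closed_segment s (s + R). norm (u (Suc n) t - x t) \<le> C2 * ?k ^ n"
      using local_tail[of "s - R"] local_tail[of "s + R"] by blast
    define C where "C = max C1 C2"
    have le: "norm (u (Suc n) t - x t) \<le> C * ?k ^ n" if "t \<in> {s - R..s + R}" for n t
    proof -
      have "norm (u (Suc n) t - x t) \<le> C1 * ?k ^ n \<or> norm (u (Suc n) t - x t) \<le> C2 * ?k ^ n"
        using C that \<open>0 < R\<close> by (cases "t \<le> s") (auto simp: closed_segment_eq_real_ivl)
      moreover have "C1 * ?k ^ n \<le> C * ?k ^ n" "C2 * ?k ^ n \<le> C * ?k ^ n"
        using k by (auto simp: C_def intro!: mult_right_mono)
      ultimately show ?thesis by linarith
    qed
    have "uniform_limit {s - R..s + R} (\<lambda>n. u (Suc n)) x sequentially"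
    proof (rule uniform_limitI)
      fix e :: real assume "0 < e"
      then have "\<forall>\<^sub>F n in sequentially. C * ?k ^ n < e"
        using order_tendstoD(2)[OF zero] by blast
      then show "\<forall>\<^sub>F n in sequentially. \<forall>t\<in>{s - R..s + R}. dist (u (Suc n) t) (x t) < e"
        by eventually_elim (auto simp: dist_norm intro: le_less_trans[OF le])
    qed
    then have "continuous_on {s - R..s + R} x"
    proof (rule uniform_limit_theorem[rotated])
      show "\<forall>\<^sub>F n in sequentially. continuous_on {s - R..s + R} (u (Suc n))"
        using u_ok by (intro always_eventually allI) (auto simp: ok_def intro: continuous_on_subset)
    qed simp
    moreover have "t \<in> interior {s - R..s + R}" by (auto simp: R_def)
    ultimately show "isCont x t" by (rule continuous_on_interior)
  qed
  have "P t (x t) = x t" for t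
    using blinfun.tendsto[OF tendsto_const lim, of "P t" t] lim[of t] u_ok
    by (simp add: ok_def LIMSEQ_unique)
  with cont_x have x_ok: "ok x" by (simp add: ok_def)
  have "\<Gamma> x t = x t" for t
  proof -
    have "norm (\<Gamma> (u n) t - \<Gamma> x t) \<le> (?k * (c / (1 - ?k)) * \<alpha> t s) * ?k ^ n" for n
      using step[OF u_ok x_ok _ tail, of n t] c k by (simp add: mult_ac)
    then have "(\<lambda>n. \<Gamma> (u n) t - \<Gamma> x t) \<longlonglongrightarrow> 0"
      by (intro Lim_null_comparison[OF _ zero] always_eventually allI)
    then have "(\<lambda>n. u (Suc n) t) \<longlonglongrightarrow> \<Gamma> x t" by (simp add: u_Suc LIM_zero_iff)
    then show ?thesis using LIMSEQ_Suc[OF lim] LIMSEQ_unique by blast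
  qed
  then have "\<Gamma> x = x" by blast
  then have "reduced_solution p x"
    using \<Gamma>_mild[OF x_ok] x_ok by (simp add: reduced_solution_def ok_def)
  moreover have "x s = \<xi>" by (subst \<open>\<Gamma> x = x\<close>[symmetric]) (simp add: \<Gamma>_def)
  ultimately show ?thesis by blast
qed

end

section \<open>The graph transform\<close>

lemma flow_eq:
  assumes "well_posed A f" "perturbed_solution A f z"
  shows "flow A f t s (z s) = z t"
proof -
  have "(THE v. perturbed_solution A f v \<and> v s = z s) = z"
    using assms by (intro the1_equality) (auto simp: well_posed_def)
  then show ?thesis by (simp add: flow_def)
qed

text \<open>By invariance \<open>P 0 \<noteq> 0\<close> means that no central space is trivial. If all of them are trivial, the
  weight \<open>\<alpha>\<close> is an arbitrary positive function, but then the zero section is the only candidate for \<open>\<phi>\<close>.\<close>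
locale nontrivial_trichotomy = trichotomy +
  assumes P0: "P 0 \<noteq> 0"
begin

definition trajectory :: "(real \<Rightarrow> 'a \<Rightarrow> 'a) \<Rightarrow> real \<Rightarrow> 'a \<Rightarrow> real \<Rightarrow> 'a" where
  "trajectory p s \<xi> = (SOME x. reduced_solution p x \<and> x s = P s \<xi>)"

definition graph_transform :: "(real \<Rightarrow> 'a \<Rightarrow> 'a) \<Rightarrow> real \<Rightarrow> 'a \<Rightarrow> 'a" where
  "graph_transform p s \<xi> = transverse (on_graph p (trajectory p s \<xi>)) s"

lemma trajectory:
  assumes "p \<in> lip_graphs"
  shows "reduced_solution p (trajectory p s \<xi>)" "trajectory p s \<xi> s = P s \<xi>"
  using someI_ex[OF reduced_exists[OF assms proj(1), of s \<xi>]] by (simp_all add: trajectory_def)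

lemma trajectory_unique:
  assumes "p \<in> lip_graphs" "reduced_solution p x"
  shows "trajectory p s (x s) = x"
proof
  fix t
  have "x s = P s (x s)" using assms(2) by (simp add: reduced_solution_def)
  then show "trajectory p s (x s) t = x t"
    using reduced_lipschitz[OF P0 assms(1) trajectory(1)[OF assms(1)] assms(2), of s "x s" t s]
      trajectory(2)[OF assms(1), of s "x s"] by simp
qed

lemma on_graph_bound:
  assumes p: "p \<in> lip_graphs" and x: "reduced_solution p x"
  shows "norm (on_graph p x r) \<le> (1 + N) * M * norm (x s) * (L r * \<alpha> r s)"
proof -
  have "norm (on_graph p x r - on_graph p (\<lambda>_. 0) r) \<le> L r * ((1 + N) * norm (x r - 0) + 0)"
    by (rule on_graph_diff[OF p]) (use x in \<open>auto simp: reduced_solution_def\<close>)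
  moreover have "on_graph p (\<lambda>_. 0) r = 0" using p by (simp add: on_graph_def lip_graphsD)
  ultimately have "norm (on_graph p x r) \<le> L r * ((1 + N) * norm (x r))" by simp
  also have "\<dots> \<le> L r * ((1 + N) * (M * norm (x s) * \<alpha> r s))"
    using N(1) by (intro mult_left_mono reduced_growth[OF P0 p x]) auto
  finally show ?thesis by (simp add: mult_ac)
qed

lemma admissible_on_graph:
  assumes p: "p \<in> lip_graphs" and x: "reduced_solution p x"
  shows "admissible (on_graph p x)"
  unfolding admissible_def
proof (intro conjI allI)
  show "continuous_on UNIV (on_graph p x)"
    using x by (intro on_graph_cont p) (simp add: reduced_solution_def)
  show "\<exists>c\<ge>0. \<forall>r. norm (on_graph p x r) \<le> c * (L r * \<alpha> r s)" for s
    using on_graph_bound[OF p x, of _ s] M_ge_1 N(1)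
    by (intro exI[of _ "(1 + N) * M * norm (x s)"]) auto
qed

text \<open>The single estimate behind both properties of the transform: \<open>E = 0\<close> gives its Lipschitz
  constant in the base point, and equal initial values give the contraction.\<close>
lemma transverse_on_graph_diff:
  assumes p: "p \<in> lip_graphs" "q \<in> lip_graphs"
    and x: "reduced_solution p x" and y: "reduced_solution q y"
    and E: "0 \<le> E" "\<And>r. norm (p r (y r) - q r (y r)) \<le> E * \<alpha> r s"
  shows "norm (transverse (on_graph p x) s - transverse (on_graph q y) s)
    \<le> ((1 + N) * (M * (norm (x s - y s) + \<sigma> * E)) + E) * \<omega>"
proof (rule transverse_diff[OF admissible_on_graph[OF p(1) x] admissible_on_graph[OF p(2) y]])
  show "0 \<le> (1 + N) * (M * (norm (x s - y s) + \<sigma> * E)) + E"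
    using N(1) M_ge_1 E(1) sigma(2) by (intro add_nonneg_nonneg mult_nonneg_nonneg) auto
  fix r
  have "norm (on_graph p x r - on_graph q y r) \<le> L r * ((1 + N) * norm (x r - y r) + E * \<alpha> r s)"
    using x y E(2) by (intro on_graph_diff p) (auto simp: reduced_solution_def)
  also have "\<dots> \<le> L r * ((1 + N) * (M * (norm (x s - y s) + \<sigma> * E) * \<alpha> r s) + E * \<alpha> r s)"
    using N(1) by (intro mult_left_mono add_right_mono reduced_diff[OF P0 p x y E]) auto
  finally show "norm (on_graph p x r - on_graph q y r)
      \<le> ((1 + N) * (M * (norm (x s - y s) + \<sigma> * E)) + E) * (L r * \<alpha> r s)"
    by (simp add: algebra_simps)
qed

text \<open>With \<open>E = D * M * \<parallel>P s \<xi>\<parallel>\<close> in the previous estimate, the factor \<open>(1 + N) * M * \<sigma> + 1\<close> in front of \<open>E\<close>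
  equals \<open>M\<close>.\<close>
lemma graph_transform_contraction:
  assumes p: "p \<in> lip_graphs" "q \<in> lip_graphs"
    and D: "0 \<le> D" "\<And>t x. norm (p t x - q t x) \<le> D * norm (P t x)"
  shows "norm (graph_transform p s \<xi> - graph_transform q s \<xi>) \<le> (\<omega> * M\<^sup>2) * D * norm (P s \<xi>)"
proof -
  let ?x = "trajectory p s \<xi>" and ?y = "trajectory q s \<xi>"
  let ?E = "D * (M * norm (P s \<xi>))"
  have "norm (graph_transform p s \<xi> - graph_transform q s \<xi>)
      \<le> ((1 + N) * (M * (norm (?x s - ?y s) + \<sigma> * ?E)) + ?E) * \<omega>"
    unfolding graph_transform_def
  proof (rule transverse_on_graph_diff[OF p trajectory(1)[OF p(1)] trajectory(1)[OF p(2)]])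
    show "0 \<le> ?E" using D(1) M_ge_1 by auto
    fix r
    have "norm (p r (?y r) - q r (?y r)) \<le> D * norm (P r (?y r))" by (rule D(2))
    also have "P r (?y r) = ?y r" using trajectory(1)[OF p(2)] by (simp add: reduced_solution_def)
    also have "D * norm (?y r) \<le> D * (M * norm (?y s) * \<alpha> r s)"
      by (intro mult_left_mono reduced_growth[OF P0 p(2)] trajectory p D(1))
    finally show "norm (p r (?y r) - q r (?y r)) \<le> ?E * \<alpha> r s"
      by (simp add: trajectory(2)[OF p(2)] mult_ac)
  qed
  also have "\<dots> = (1 + \<sigma> * (1 + N) * M) * ?E * \<omega>"
    using trajectory(2)[OF p(1)] trajectory(2)[OF p(2)] by (simp add: algebra_simps)
  also have "\<dots> = (\<omega> * M\<^sup>2) * D * norm (P s \<xi>)"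
    unfolding M_eq by (simp add: power2_eq_square mult_ac)
  finally show ?thesis .
qed

text \<open>A central solution through \<open>x s\<close> is also the one through \<open>x t\<close>, so along it the transform is
  one function of time that comes from a single forcing term.\<close>
lemma graph_transform_along:
  assumes "p \<in> lip_graphs" "reduced_solution p x"
  shows "graph_transform p t (x t) = transverse (on_graph p x) t"
  by (simp add: graph_transform_def trajectory_unique[OF assms])

lemma graph_transform_Lipschitz:
  assumes p: "p \<in> lip_graphs"
  shows "norm (graph_transform p s \<xi> - graph_transform p s \<eta>) \<le> N * norm (P s \<xi> - P s \<eta>)"
proof -
  have "norm (graph_transform p s \<xi> - graph_transform p s \<eta>)
      \<le> ((1 + N) * (M * (norm (P s \<xi> - P s \<eta>) + \<sigma> * 0)) + 0) * \<omega>"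
    unfolding graph_transform_def trajectory(2)[OF p, symmetric]
    by (rule transverse_on_graph_diff[OF p p trajectory(1)[OF p] trajectory(1)[OF p]]) auto
  also have "\<dots> = (\<omega> * (1 + N) * M) * norm (P s \<xi> - P s \<eta>)" by (simp add: mult_ac)
  also have "\<dots> \<le> N * norm (P s \<xi> - P s \<eta>)" by (intro mult_right_mono omega_M) simp
  finally show ?thesis .
qed

text \<open>The integrals that define the transform need not be dominated uniformly in \<open>s\<close>. Along the central solution
  through \<open>(s0, \<xi>0)\<close>, however, the transform is a mild solution and hence continuous in time, and moving
  from that solution to a nearby point at the same time is controlled by the Lipschitz estimate.\<close>
lemma graph_transform_isCont:
  assumes p: "p \<in> lip_graphs"
  shows "isCont (\<lambda>z. graph_transform p (fst z) (snd z)) (s0, \<xi>0)"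
proof -
  let ?x = "trajectory p s0 \<xi>0" and ?g = "\<lambda>z. graph_transform p (fst z) (snd z)"
  have x: "reduced_solution p ?x" "?x s0 = P s0 \<xi>0" using trajectory[OF p] by auto
  then have xc: "continuous_on UNIV ?x" and xP: "P t (?x t) = ?x t" for t
    by (auto simp: reduced_solution_def)
  have adm: "admissible (on_graph p ?x)" by (rule admissible_on_graph[OF p x(1)])
  then have wc: "continuous_on UNIV (on_graph p ?x)" by (simp add: admissible_def)
  have "continuous_on UNIV (transverse (on_graph p ?x))"
    by (rule mild_solution_continuous[OF _ transverse_mild[OF adm]]) (intro continuous_intros wc)
  then have tr: "continuous_on UNIV (\<lambda>z :: real \<times> 'a. transverse (on_graph p ?x) (fst z))"
    by (rule continuous_on_compose2) (auto intro!: continuous_intros)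
  have d: "continuous_on UNIV (\<lambda>z :: real \<times> 'a. N * norm (P (fst z) (snd z) - ?x (fst z)))"
    by (intro continuous_intros continuous_on_compose2[OF xc]) auto
  have lim1: "((\<lambda>z. transverse (on_graph p ?x) (fst z)) \<longlongrightarrow> ?g (s0, \<xi>0)) (at (s0, \<xi>0))"
    using continuous_on_interior[OF tr, of "(s0, \<xi>0)"] by (simp add: isCont_def graph_transform_def)
  have lim2: "((\<lambda>z. N * norm (P (fst z) (snd z) - ?x (fst z))) \<longlongrightarrow> 0) (at (s0, \<xi>0))"
    using continuous_on_interior[OF d, of "(s0, \<xi>0)"] x(2) by (simp add: isCont_def)
  have "norm (?g z - transverse (on_graph p ?x) (fst z)) \<le> N * norm (P (fst z) (snd z) - ?x (fst z))" for z
    using graph_transform_Lipschitz[OF p, of "fst z" "snd z" "?x (fst z)"] xP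
    by (simp add: graph_transform_along[OF p x(1)])
  then have "((\<lambda>z. ?g z - transverse (on_graph p ?x) (fst z)) \<longlongrightarrow> 0) (at (s0, \<xi>0))"
    by (intro Lim_null_comparison[OF _ lim2] always_eventually allI)
  from tendsto_add[OF this lim1] show ?thesis by (simp add: isCont_def)
qed

lemma graph_transform_lip_graphs:
  assumes p: "p \<in> lip_graphs"
  shows "graph_transform p \<in> lip_graphs"
proof -
  have "graph_transform p t 0 = 0" for t
  proof -
    have "graph_transform p t ((\<lambda>_. 0) t) = transverse (on_graph p (\<lambda>_. 0)) t"
      by (rule graph_transform_along[OF p zero_reduced[OF p]])
    also have "on_graph p (\<lambda>_. 0) = (\<lambda>_. 0)" using p by (auto simp: on_graph_def lip_graphsD)
    also have "transverse (\<lambda>_. 0) t = 0" by (simp add: transverse_def limI)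
    finally show ?thesis by simp
  qed
  moreover have "continuous_on UNIV (\<lambda>(t, x). graph_transform p t x)"
    using graph_transform_isCont[OF p] by (auto intro!: continuous_at_imp_continuous_on simp: case_prod_beta')
  moreover have "P t (graph_transform p t x) = 0" for t x
    unfolding graph_transform_def
    by (rule transverse_kernel[OF admissible_on_graph[OF p trajectory(1)[OF p]]])
  ultimately show ?thesis using graph_transform_Lipschitz[OF p] by (simp add: lip_graphs_def)
qed

section \<open>Its fixed point and the invariant graphs\<close>

text \<open>The iterates of the zero graph converge with increments at most \<open>N * \<parallel>P t x\<parallel> * k ^ n\<close>. This is uniform on the open
  sets where \<open>\<parallel>P t x\<parallel>\<close> is bounded, so the limit is continuous.\<close>
lemma graph_transform_fixed_point_exists:
  "\<exists>p\<in>lip_graphs. graph_transform p = p"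
proof -
  let ?k = "\<omega> * M\<^sup>2"
  have k: "0 \<le> ?k" "?k < 1" using contraction omega(2) by auto
  define p where "p n = (graph_transform ^^ n) (\<lambda>_ _. 0)" for n
  have p_Suc: "p (Suc n) = graph_transform (p n)" for n by (simp add: p_def)
  have p0: "p 0 \<in> lip_graphs" using N(1) by (simp add: p_def lip_graphs_def)
  have p: "p n \<in> lip_graphs" for n
    by (induction n) (use p0 graph_transform_lip_graphs p_Suc in auto)
  have inc: "norm (p (Suc n) t x - p n t x) \<le> N * norm (P t x) * ?k ^ n" for n t x
  proof (induction n arbitrary: t x)
    case 0
    show ?case using lip_graphsD(4)[OF p[of 1], of t x 0] lip_graphsD(2)[OF p[of 1]]
      by (simp add: p_def)
  next
    case (Suc n)
    have "norm (graph_transform (p (Suc n)) t x - graph_transform (p n) t x) \<le> ?k * (N * ?k ^ n) * norm (P t x)"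
      using Suc N(1) k by (intro graph_transform_contraction p) (auto simp: mult_ac)
    then show ?case by (simp add: p_Suc mult_ac)
  qed
  define q where "q t x = lim (\<lambda>n. p n t x)" for t x
  have lim: "(\<lambda>n. p n t x) \<longlonglongrightarrow> q t x" for t x
    unfolding q_def convergent_LIMSEQ_iff[symmetric]
    by (rule geometric_increments_convergent[of "\<lambda>n. p n t x", OF inc k])
  have tail: "norm (p n t x - q t x) \<le> N * norm (P t x) / (1 - ?k) * ?k ^ n" for n t x
    by (rule geometric_increments_tail[of "\<lambda>n. p n t x", OF inc k lim])
  have zero: "(\<lambda>n. a * ?k ^ n) \<longlonglongrightarrow> 0" for a :: real
    using k by (intro tendsto_mult_right_zero LIMSEQ_realpow_zero) auto
  have q_cont: "continuous_on UNIV (\<lambda>z. q (fst z) (snd z))"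
  proof (rule continuous_at_imp_continuous_on, rule ballI)
    fix z0 :: "real \<times> 'a"
    define R where "R = norm (P (fst z0) (snd z0)) + 1"
    define U where "U = {z :: real \<times> 'a. norm (P (fst z) (snd z)) < R}"
    have "open U"
      unfolding U_def by (intro open_Collect_less continuous_intros)
    have "uniform_limit U (\<lambda>n z. p n (fst z) (snd z)) (\<lambda>z. q (fst z) (snd z)) sequentially"
    proof (rule uniform_limitI)
      fix e :: real assume "0 < e"
      then have "\<forall>\<^sub>F n in sequentially. N * R / (1 - ?k) * ?k ^ n < e"
        using order_tendstoD(2)[OF zero] by blast
      then show "\<forall>\<^sub>F n in sequentially. \<forall>z\<in>U. dist (p n (fst z) (snd z)) (q (fst z) (snd z)) < e"
      proof eventually_elim
        fix n assume n: "N * R / (1 - ?k) * ?k ^ n < e"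
        show "\<forall>z\<in>U. dist (p n (fst z) (snd z)) (q (fst z) (snd z)) < e"
        proof
          fix z assume "z \<in> U"
          then have "N * norm (P (fst z) (snd z)) / (1 - ?k) * ?k ^ n \<le> N * R / (1 - ?k) * ?k ^ n"
            using N(1) k by (intro mult_right_mono divide_right_mono mult_left_mono) (auto simp: U_def)
          then show "dist (p n (fst z) (snd z)) (q (fst z) (snd z)) < e"
            using tail[of n "fst z" "snd z"] n by (simp add: dist_norm)
        qed
      qed
    qed
    then have "continuous_on U (\<lambda>z. q (fst z) (snd z))"
    proof (rule uniform_limit_theorem[rotated])
      show "\<forall>\<^sub>F n in sequentially. continuous_on U (\<lambda>z. p n (fst z) (snd z))"
        using lip_graphsD(1)[OF p]
        by (intro always_eventually allI) (auto simp: case_prod_beta' intro: continuous_on_subset)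
    qed simp
    moreover have "z0 \<in> U" by (simp add: U_def R_def)
    ultimately show "isCont (\<lambda>z. q (fst z) (snd z)) z0"
      using \<open>open U\<close> by (simp add: continuous_on_eq_continuous_at)
  qed
  have q: "q \<in> lip_graphs"
    unfolding lip_graphs_def
  proof (intro CollectI conjI allI)
    show "continuous_on UNIV (\<lambda>(t, x). q t x)" using q_cont by (simp add: case_prod_beta')
    show "q t 0 = 0" for t
      using lim[of t 0] lip_graphsD(2)[OF p] by (simp add: LIMSEQ_const_iff)
    show "P t (q t x) = 0" for t x
      using blinfun.tendsto[OF tendsto_const lim, of "P t" t x] lip_graphsD(3)[OF p]
      by (simp add: LIMSEQ_const_iff)
    show "norm (q t x - q t y) \<le> N * norm (P t x - P t y)" for t x y
      by (rule tendsto_upperbound[OF tendsto_norm[OF tendsto_diff[OF lim lim]]])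
         (use lip_graphsD(4)[OF p] in auto)
  qed
  have "graph_transform q t x = q t x" for t x
  proof -
    have "norm (graph_transform (p n) t x - graph_transform q t x) \<le> ?k * (N / (1 - ?k) * norm (P t x)) * ?k ^ n" for n
    proof -
      have "norm (graph_transform (p n) t x - graph_transform q t x) \<le> ?k * (N / (1 - ?k) * ?k ^ n) * norm (P t x)"
        using tail[of n] N(1) k by (intro graph_transform_contraction p q) (auto simp: mult_ac)
      then show ?thesis by (simp add: mult_ac)
    qed
    then have "(\<lambda>n. graph_transform (p n) t x - graph_transform q t x) \<longlonglongrightarrow> 0"
      by (intro Lim_null_comparison[OF _ zero] always_eventually allI)
    then have "(\<lambda>n. p (Suc n) t x) \<longlonglongrightarrow> graph_transform q t x" by (simp add: p_Suc LIM_zero_iff)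
    then show ?thesis using LIMSEQ_Suc[OF lim] LIMSEQ_unique by blast
  qed
  then show ?thesis using q by (intro bexI[of _ q]) blast+
qed

text \<open>Two graphs of slope \<open>N\<close> are at distance at most \<open>2 * N * \<parallel>P t x\<parallel>\<close>, so the contraction can be
  iterated on their difference.\<close>
lemma graph_transform_fixed_point_unique:
  assumes p: "p \<in> lip_graphs" "graph_transform p = p" and q: "q \<in> lip_graphs" "graph_transform q = q"
  shows "p = q"
proof (intro ext)
  fix t x
  let ?k = "\<omega> * M\<^sup>2"
  have k: "0 \<le> ?k" "?k < 1" using contraction omega(2) by auto
  have le: "norm (p t x - q t x) \<le> (2 * N * ?k ^ n) * norm (P t x)" for n t x
  proof (induction n arbitrary: t x)
    case 0
    have "norm (p t x - q t x) \<le> norm (p t x) + norm (q t x)" by (rule norm_triangle_ineq4)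
    also have "\<dots> \<le> N * norm (P t x) + N * norm (P t x)"
      using lip_graphsD(4)[OF p(1), of t x 0] lip_graphsD(2)[OF p(1)]
        lip_graphsD(4)[OF q(1), of t x 0] lip_graphsD(2)[OF q(1)] by (intro add_mono) auto
    finally show ?case by simp
  next
    case (Suc n)
    have "norm (graph_transform p t x - graph_transform q t x) \<le> ?k * (2 * N * ?k ^ n) * norm (P t x)"
      using Suc N(1) k by (intro graph_transform_contraction p q) auto
    then show ?case by (simp add: p q mult_ac)
  qed
  have "(\<lambda>n. (2 * N * ?k ^ n) * norm (P t x)) \<longlonglongrightarrow> 0"
    using k by (intro tendsto_mult_left_zero tendsto_mult_right_zero LIMSEQ_realpow_zero) auto
  then have "norm (p t x - q t x) \<le> 0"
    using le by (intro LIMSEQ_le_const) auto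
  then show "p t x = q t x" by simp
qed

text \<open>The central part \<open>x\<close> solves the equation forced by \<open>P r (w r)\<close>, and the height \<open>p t (x t)\<close>, being
  the transverse integral, solves the one forced by \<open>w r - P r (w r)\<close>. Their sum is
  therefore a solution of the full equation.\<close>
lemma flow_on_invariant_graph:
  assumes wp: "well_posed A f" and p: "p \<in> lip_graphs" "graph_transform p = p" and \<xi>: "P s \<xi> = \<xi>"
  shows "flow A f t s (\<xi> + p s \<xi>) = trajectory p s \<xi> t + p t (trajectory p s \<xi> t)"
proof -
  let ?x = "trajectory p s \<xi>" and ?w = "on_graph p (trajectory p s \<xi>)"
  let ?z = "\<lambda>t. ?x t + p t (?x t)"
  have x: "reduced_solution p ?x" "?x s = \<xi>" using trajectory[OF p(1), of s \<xi>] \<xi> by auto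
  have adm: "admissible ?w" by (rule admissible_on_graph[OF p(1) x(1)])
  then have wc: "continuous_on UNIV ?w" by (simp add: admissible_def)
  have "(\<lambda>t. p t (?x t)) = transverse ?w"
    using graph_transform_along[OF p(1) x(1)] p(2) by auto
  then have "mild_solution T (\<lambda>r. ?w r - P r (?w r)) (\<lambda>t. p t (?x t))"
    using transverse_mild[OF adm] by simp
  then have "mild_solution T (\<lambda>r. P r (?w r) + (?w r - P r (?w r))) ?z"
    using x(1) by (intro mild_solution_add continuous_intros wc) (auto simp: reduced_solution_def)
  then have "mild_solution T ?w ?z" by simp
  then have "perturbed_solution A f ?z"
    using mild_solution_iff[OF wc] by (simp add: perturbed_solution_def on_graph_def)
  from flow_eq[OF wp this, of t s] show ?thesis by (simp add: x(2))
qed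

lemma invariant_imp_fixed:
  assumes wp: "well_posed A f" and q: "q \<in> lip_graphs"
    and inv: "\<And>s \<xi> t. P s \<xi> = \<xi> \<Longrightarrow> \<exists>\<eta>. P t \<eta> = \<eta> \<and> flow A f t s (\<xi> + q s \<xi>) = \<eta> + q t \<eta>"
    and lim: "\<And>s. ((\<lambda>r. \<beta>m s r * \<alpha> r s) \<longlongrightarrow> 0) at_top" "\<And>s. ((\<lambda>r. \<beta>p s r * \<alpha> r s) \<longlongrightarrow> 0) at_bot"
  shows "graph_transform q = q"
proof (intro ext)
  fix s \<xi>'
  define \<xi> where "\<xi> = P s \<xi>'"
  have \<xi>: "P s \<xi> = \<xi>" by (simp add: \<xi>_def)
  obtain z where z: "perturbed_solution A f z" "z s = \<xi> + q s \<xi>"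
    using wp unfolding well_posed_def by blast
  define x where "x t = P t (z t)" for t
  have z_eq: "z t = x t + q t (x t)" for t
  proof -
    obtain \<eta> where \<eta>: "P t \<eta> = \<eta>" "flow A f t s (\<xi> + q s \<xi>) = \<eta> + q t \<eta>" using inv[OF \<xi>] by blast
    then have zt: "z t = \<eta> + q t \<eta>" using flow_eq[OF wp z(1), of t s] z(2) by simp
    then have "x t = \<eta>" using \<eta>(1) lip_graphsD(3)[OF q] by (simp add: x_def blinfun.add_right)
    then show ?thesis using zt by simp
  qed
  have "continuous_on UNIV z"
    using z(1) by (auto intro!: continuous_at_imp_continuous_on has_vector_derivative_continuous simp: perturbed_solution_def)
  then have xc: "continuous_on UNIV x" unfolding x_def by (intro continuous_intros)
  let ?w = "on_graph q x"
  have wc: "continuous_on UNIV ?w" by (rule on_graph_cont[OF q xc])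
  have "f t (z t) = ?w t" for t unfolding on_graph_def by (simp only: z_eq[symmetric])
  then have mild: "mild_solution T ?w z"
    using z(1) mild_solution_iff[OF wc, of z] by (simp add: perturbed_solution_def)
  have "mild_solution T (\<lambda>r. P r (?w r)) x"
    unfolding x_def[abs_def] using mild_solution_commute[OF wc commute(1) mild] unfolding x_def[abs_def] .
  then have red: "reduced_solution q x"
    using xc by (simp add: reduced_solution_def x_def)
  have xs: "x s = \<xi>" using z(2) \<xi> lip_graphsD(3)[OF q] by (simp add: x_def blinfun.add_right)
  have "norm (z r) \<le> (1 + N) * M * norm (x s) * \<alpha> r s" for r
  proof -
    have "norm (z r) \<le> norm (x r) + norm (q r (x r))" unfolding z_eq by (rule norm_triangle_ineq)
    also have "norm (q r (x r)) \<le> N * norm (x r)"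
      using lip_graphsD(4)[OF q, of r "x r" 0] lip_graphsD(2)[OF q] by (simp add: x_def)
    also have "norm (x r) + N * norm (x r) = (1 + N) * norm (x r)" by (simp add: algebra_simps)
    also have "\<dots> \<le> (1 + N) * (M * norm (x s) * \<alpha> r s)"
      using N(1) by (intro mult_left_mono reduced_growth[OF P0 q red]) auto
    finally show ?thesis by (simp add: mult_ac)
  qed
  then have "z s - P s (z s) = transverse ?w s"
    by (rule transverse_unique[OF admissible_on_graph[OF q red] mild _ lim])
  then have "q s \<xi> = graph_transform q s \<xi>"
    using graph_transform_along[OF q red, of s] z(2) \<xi> lip_graphsD(3)[OF q]
    by (simp add: xs blinfun.add_right)
  then show "graph_transform q s \<xi>' = q s \<xi>'"
    using lip_graphsD(5)[OF q, of s \<xi>'] lip_graphsD(5)[OF graph_transform_lip_graphs[OF q], of s \<xi>']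
    by (simp add: \<xi>_def)
qed

end

section \<open>Functions on the central bundle\<close>

context trichotomy
begin

lemma range_P_iff: "\<xi> \<in> range (P t) \<longleftrightarrow> P t \<xi> = \<xi>"
  by (metis proj(1) rangeE rangeI)

lemma kernel_P_iff: "y \<in> {a + b |a b. a \<in> range (Qp t) \<and> b \<in> range (Qm t)} \<longleftrightarrow> P t y = 0"
proof
  assume "P t y = 0"
  then have "y = Qp t y + Qm t y" using Q_sum[of t y] by simp
  then show "y \<in> {a + b |a b. a \<in> range (Qp t) \<and> b \<in> range (Qm t)}" by blast
qed (auto simp: blinfun.add_right)

lemma A_set_imp_lip_graphs:
  assumes "\<phi> \<in> A_set P Qp Qm N"
  shows "(\<lambda>t x. \<phi> (t, P t x)) \<in> lip_graphs"
proof -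
  have G: "(t, P t x) \<in> G_set P" for t x by (simp add: G_set_def)
  have \<phi>: "continuous_on (G_set P) \<phi>" "\<And>t. \<phi> (t, 0) = 0"
    "\<And>t x. P t (\<phi> (t, P t x)) = 0"
    "\<And>t x y. norm (\<phi> (t, P t x) - \<phi> (t, P t y)) \<le> N * norm (P t x - P t y)"
    using assms G by (fastforce simp: A_set_def kernel_P_iff simp del: mem_Collect_eq)+
  have "continuous_on UNIV (\<lambda>z. \<phi> (fst z, P (fst z) (snd z)))"
    by (rule continuous_on_compose2[OF \<phi>(1)]) (auto intro!: continuous_intros simp: G)
  then show ?thesis using \<phi> by (auto simp: lip_graphs_def case_prod_beta')
qed

lemma lip_graphs_imp_A_set:
  assumes p: "p \<in> lip_graphs"
  shows "restrict (\<lambda>(t, x). p t x) (G_set P) \<in> A_set P Qp Qm N"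
proof -
  have G: "(t, x) \<in> G_set P \<longleftrightarrow> P t x = x" for t x by (simp add: G_set_def range_P_iff)
  have "continuous_on (G_set P) (restrict (\<lambda>(t, x). p t x) (G_set P))"
    using continuous_on_subset[OF lip_graphsD(1)[OF p] subset_UNIV] by (rule continuous_on_eq) auto
  moreover have "norm (p t x - p t y) \<le> N * norm (x - y)" if "P t x = x" "P t y = y" for t x y
    using lip_graphsD(4)[OF p, of t x y] that by simp
  ultimately show ?thesis
    using lip_graphsD(2,3)[OF p] unfolding A_set_def by (auto simp only: kernel_P_iff) (auto simp: G)
qed

end

section \<open>The invariant manifold\<close>

text \<open>Put \<open>h N = N / (1 + N) - \<sigma> * N\<close>. The last two inequalities say that \<open>\<omega> \<le> h N\<close> and \<open>h' N > 0\<close>. If \<open>\<sigma> \<le> 1 / 4\<close>, then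
  \<open>h\<close> increases on \<open>(0, 1)\<close> up to \<open>h 1 = 1 / 2 - \<sigma> > \<omega>\<close>. Otherwise \<open>h\<close> is maximal at \<open>1 / sqrt \<sigma> - 1\<close>, which lies in \<open>(0, 1)\<close>,
  with value \<open>(1 - sqrt \<sigma>)\<^sup>2 = 1 / 2 - \<sigma> + (1 - 2 * sqrt \<sigma>)\<^sup>2 / 2 > \<omega>\<close>. In the
  first case any \<open>N\<close> between \<open>2 * (\<sigma> + \<omega>)\<close> and \<open>1\<close> works, in the second one any \<open>N\<close> slightly below the
  maximum point.\<close>
lemma Lipschitz_constant_exists:
  fixes \<sigma> \<omega> :: real
  assumes "0 \<le> \<sigma>" "0 \<le> \<omega>" "2 * \<sigma> + 2 * \<omega> < 1"
  shows "\<exists>N. 0 < N \<and> N < 1 \<and> \<sigma> * (1 + N)\<^sup>2 < 1 \<and> (1 + N) * (\<sigma> * N + \<omega>) \<le> N"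
proof (cases "\<sigma> \<le> 1 / 4")
  case True
  define N where "N = (1 + 2 * (\<sigma> + \<omega>)) / 2"
  have N: "0 < N" "N < 1" "2 * (\<sigma> + \<omega>) < N" using assms by (auto simp: N_def field_simps)
  have "\<sigma> * (1 + N)\<^sup>2 \<le> 1 / 4 * (1 + N)\<^sup>2" using True by (intro mult_right_mono) auto
  also have "\<dots> < 1 / 4 * 2\<^sup>2" using N by (intro mult_strict_left_mono power_strict_mono) auto
  finally have "\<sigma> * (1 + N)\<^sup>2 < 1" by simp
  moreover have "(1 + N) * (\<sigma> * N + \<omega>) \<le> 2 * (\<sigma> * 1 + \<omega>)"
    using N assms by (intro mult_mono add_mono order_refl) auto
  ultimately show ?thesis using N by (intro exI[of _ N]) auto
next
  case False
  define q where "q = sqrt \<sigma>"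
  define m where "m = 1 / q"
  have \<sigma>: "1 / 4 < \<sigma>" "\<sigma> < 1" using False assms by auto
  then have q: "q < 1" "1 / 2 < q" "\<sigma> = q * q"
    using real_less_rsqrt[of "1 / 2" \<sigma>] by (auto simp: q_def power2_eq_square)
  then have m: "1 < m" "m < 2" "\<sigma> * m\<^sup>2 = 1" by (auto simp: m_def field_simps power2_eq_square)
  define h where "h N = N / (1 + N) - \<sigma> * N" for N
  have "isCont h (m - 1)" using m by (auto simp: h_def[abs_def] intro!: continuous_intros)
  then have "(h \<longlongrightarrow> h (m - 1)) (at_left (m - 1))"
    by (simp add: isCont_def filterlim_at_split)
  moreover have "\<omega> < h (m - 1)"
  proof -
    have "h (m - 1) = (1 - q)\<^sup>2"
      using q by (simp add: h_def m_def power2_eq_square field_simps)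
    moreover have "0 \<le> (1 - 2 * q)\<^sup>2" by simp
    ultimately show ?thesis using assms(3) q(3) by (simp add: power2_eq_square algebra_simps)
  qed
  ultimately have "\<forall>\<^sub>F N in at_left (m - 1). \<omega> < h N" by (rule order_tendstoD(1))
  moreover have "\<forall>\<^sub>F N in at_left (m - 1). N \<in> {0<..<m - 1}"
    using m by (intro eventually_at_leftI[of 0]) auto
  ultimately have "\<forall>\<^sub>F N in at_left (m - 1). \<omega> < h N \<and> N \<in> {0<..<m - 1}"
    by (rule eventually_conj)
  then obtain N where N: "\<omega> < h N" "0 < N" "N < m - 1"
    using eventually_happens'[of "at_left (m - 1)"] trivial_limit_at_left_real by fastforce
  have "\<sigma> * (1 + N)\<^sup>2 < \<sigma> * m\<^sup>2"
    using N \<sigma> by (intro mult_strict_left_mono power_strict_mono) auto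
  moreover have "(1 + N) * (\<sigma> * N + \<omega>) \<le> N"
    using N(1,2) by (simp add: h_def field_simps)
  ultimately show ?thesis using N m by (intro exI[of _ N]) auto
qed

theorem theorem3p1:
  fixes A :: "real \<Rightarrow> 'a::banach \<Rightarrow>\<^sub>L 'a"
    and T :: "real \<Rightarrow> real \<Rightarrow> 'a \<Rightarrow>\<^sub>L 'a"
    and P Qp Qm :: "real \<Rightarrow> 'a \<Rightarrow>\<^sub>L 'a"
    and \<alpha> \<beta>p \<beta>m :: "real \<Rightarrow> real \<Rightarrow> real"
    and f :: "real \<Rightarrow> 'a \<Rightarrow> 'a"
    and \<sigma> \<omega> :: ennreal
  assumes "continuous_on UNIV A"
    and "evolution_operator A T"
    and "generalized_trichotomy T P Qp Qm \<alpha> \<beta>p \<beta>m"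
    and "continuous_on UNIV (\<lambda>(t, x). f t x)"
    and "\<And>t. f t 0 = 0"
    and "\<And>t. Lip (f t) < \<infinity>"
    and "well_posed A f"
    and "integrals_defined \<alpha> \<beta>p \<beta>m f"
    and "\<sigma> = sigma_const \<alpha> f"
    and "\<omega> = omega_const \<alpha> \<beta>p \<beta>m f"
    and "\<sigma> < \<infinity>"
    and "\<omega> < \<infinity>"
    and "\<And>s. ((\<lambda>r. \<beta>m s r * \<alpha> r s) \<longlongrightarrow> 0) at_top"
    and "\<And>s. ((\<lambda>r. \<beta>p s r * \<alpha> r s) \<longlongrightarrow> 0) at_bot"
    and "2 * \<sigma> + 2 * \<omega> < 1"
  shows "\<exists>N. 0 < N \<and> N < 1 \<and>
    (\<exists>\<phi>. \<phi> \<in> A_set P Qp Qm N \<and> (\<forall>\<tau>. Psi A f \<tau> ` graph P \<phi> \<subseteq> graph P \<phi>) \<and>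
      (\<forall>\<psi>. \<psi> \<in> A_set P Qp Qm N \<and> (\<forall>\<tau>. Psi A f \<tau> ` graph P \<psi> \<subseteq> graph P \<psi>) \<longrightarrow> \<psi> = \<phi>) \<and>
      (\<forall>t s \<xi> \<xi>'. (s, \<xi>) \<in> G_set P \<longrightarrow> (s, \<xi>') \<in> G_set P \<longrightarrow>
        ennreal (norm (snd (Psi A f (t - s) (s, \<xi> + \<phi> (s, \<xi>))) -
                       snd (Psi A f (t - s) (s, \<xi>' + \<phi> (s, \<xi>')))))
          \<le> ennreal N / \<omega> * ennreal (\<alpha> t s) * ennreal (norm (\<xi> - \<xi>'))))"
proof -
  define s0 where "s0 = enn2real \<sigma>"
  define w0 where "w0 = enn2real \<omega>"
  have eq: "\<sigma> = ennreal s0" "\<omega> = ennreal w0" and nn: "0 \<le> s0" "0 \<le> w0"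
    using \<open>\<sigma> < \<infinity>\<close> \<open>\<omega> < \<infinity>\<close> by (simp_all add: s0_def w0_def)
  have "ennreal (2 * s0 + 2 * w0) < ennreal 1"
    using \<open>2 * \<sigma> + 2 * \<omega> < 1\<close> nn by (simp add: eq ennreal_plus ennreal_mult)
  then have small: "2 * s0 + 2 * w0 < 1" using nn by (subst (asm) ennreal_less_iff) auto
  obtain N where N_choice: "0 < N" "N < 1" "s0 * (1 + N)\<^sup>2 < 1" "(1 + N) * (s0 * N + w0) \<le> N"
    using Lipschitz_constant_exists[OF nn small] by blast
  interpret trichotomy A T P Qp Qm \<alpha> \<beta>p \<beta>m f s0 w0 N
    by unfold_locales (use assms N_choice nn eq in auto)
  have G: "(t, x) \<in> G_set P \<longleftrightarrow> P t x = x" for t x by (simp add: G_set_def range_P_iff)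
  have Psi: "Psi A f \<tau> (s, x) = (s + \<tau>, flow A f (s + \<tau>) s x)" for \<tau> s x by (simp add: Psi_def)
  have flow_zero: "flow A f t s 0 = 0" for t s
    using flow_eq[OF \<open>well_posed A f\<close>, of "\<lambda>_. 0" t s] by (simp add: perturbed_solution_def)
  show ?thesis
  \<comment> \<open>If the central spaces are trivial, all functions in \<open>A_set P Qp Qm N\<close> coincide with the zero section.\<close>
  proof (cases "P 0 = 0")
    case True
    have P_zero: "P t x = 0" for t x
    proof -
      have "P t (T t 0 (T 0 t x)) = T t 0 (P 0 (T 0 t x))" by (rule commute)
      with True show ?thesis by simp
    qed
    have "(\<lambda>_ _. 0) \<in> lip_graphs" using N(1) by (simp add: lip_graphs_def)
    then have mem: "restrict (\<lambda>_. 0) (G_set P) \<in> A_set P Qp Qm N"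
      using lip_graphs_imp_A_set[of "\<lambda>_ _. 0"] by (simp add: case_prod_beta')
    have uniq: "\<psi> = restrict (\<lambda>_. 0) (G_set P)" if "\<psi> \<in> A_set P Qp Qm N" for \<psi>
    proof (rule extensionalityI)
      show "\<psi> z = restrict (\<lambda>_. 0) (G_set P) z" if "z \<in> G_set P" for z
        using that \<open>\<psi> \<in> A_set P Qp Qm N\<close> by (cases z) (auto simp: G P_zero A_set_def)
    qed (use that in \<open>auto simp: A_set_def\<close>)
    show ?thesis
      by (intro exI[of _ N] conjI exI[of _ "restrict (\<lambda>_. 0) (G_set P)"] mem)
         (use uniq N_choice(1,2) in \<open>auto simp: graph_def G P_zero Psi flow_zero\<close>)
  next
    case False
    interpret nontrivial_trichotomy A T P Qp Qm \<alpha> \<beta>p \<beta>m f s0 w0 N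
      by unfold_locales (rule False)
    obtain p where p: "p \<in> lip_graphs" "graph_transform p = p"
      using graph_transform_fixed_point_exists by blast
    define \<phi> where "\<phi> = restrict (\<lambda>(t, x). p t x) (G_set P)"
    have \<phi>: "\<phi> (t, x) = p t x" if "P t x = x" for t x using that by (simp add: \<phi>_def G)
    note flow = flow_on_invariant_graph[OF \<open>well_posed A f\<close> p]
    have traj_P: "P t (trajectory p s x t) = trajectory p s x t" for t s x
      using trajectory(1)[OF p(1)] by (simp add: reduced_solution_def)
    show ?thesis
    proof (intro exI[of _ N] conjI exI[of _ \<phi>] N_choice(1) N_choice(2) allI impI)
      show "\<phi> \<in> A_set P Qp Qm N" unfolding \<phi>_def by (rule lip_graphs_imp_A_set[OF p(1)])
    next
      fix \<tau>
      show "Psi A f \<tau> ` graph P \<phi> \<subseteq> graph P \<phi>"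
      proof (rule image_subsetI)
        fix z assume "z \<in> graph P \<phi>"
        then obtain s \<xi> where z: "z = (s, \<xi> + p s \<xi>)" "P s \<xi> = \<xi>" by (auto simp: graph_def G \<phi>)
        then show "Psi A f \<tau> z \<in> graph P \<phi>"
          using traj_P[of "s + \<tau>" s \<xi>] by (auto simp: Psi flow graph_def G \<phi> intro!: exI[of _ "trajectory p s \<xi> (s + \<tau>)"])
      qed
    next
      fix \<psi> assume \<psi>: "\<psi> \<in> A_set P Qp Qm N \<and> (\<forall>\<tau>. Psi A f \<tau> ` graph P \<psi> \<subseteq> graph P \<psi>)"
      define q where "q t x = \<psi> (t, P t x)" for t x
      have q: "q \<in> lip_graphs"
        unfolding q_def[abs_def] using \<psi> by (intro A_set_imp_lip_graphs) auto
      have "graph_transform q = q"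
      proof (rule invariant_imp_fixed[OF \<open>well_posed A f\<close> q])
        fix s \<xi> t assume \<xi>: "P s \<xi> = \<xi>"
        then have "(s, \<xi> + \<psi> (s, \<xi>)) \<in> graph P \<psi>" by (auto simp: graph_def G)
        then have "Psi A f (t - s) (s, \<xi> + \<psi> (s, \<xi>)) \<in> graph P \<psi>" using \<psi> by blast
        then show "\<exists>\<eta>. P t \<eta> = \<eta> \<and> flow A f t s (\<xi> + q s \<xi>) = \<eta> + q t \<eta>"
          using \<xi> by (auto simp: graph_def G Psi q_def)
      qed (use assms in auto)
      then have "q = p" using graph_transform_fixed_point_unique p q by blast
      show "\<psi> = \<phi>"
      proof (rule extensionalityI)
        show "\<psi> \<in> extensional (G_set P)" using \<psi> by (simp add: A_set_def)
        show "\<phi> \<in> extensional (G_set P)" by (simp add: \<phi>_def)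
        show "\<psi> z = \<phi> z" if "z \<in> G_set P" for z
        proof (cases z)
          case (Pair t x)
          then have "P t x = x" using that by (simp add: G)
          then have "\<psi> (t, x) = q t x" by (simp add: q_def)
          then show ?thesis using Pair \<phi>[OF \<open>P t x = x\<close>] \<open>q = p\<close> by simp
        qed
      qed
    next
      fix t s \<xi> \<xi>' assume "(s, \<xi>) \<in> G_set P" "(s, \<xi>') \<in> G_set P"
      then have \<xi>: "P s \<xi> = \<xi>" "P s \<xi>' = \<xi>'" by (simp_all add: G)
      let ?x = "trajectory p s \<xi> t" and ?y = "trajectory p s \<xi>' t"
      let ?d = "norm ((?x + p t ?x) - (?y + p t ?y))"
      have "?d \<le> norm (?x - ?y) + norm (p t ?x - p t ?y)"
        using norm_triangle_ineq[of "?x - ?y" "p t ?x - p t ?y"] by (simp add: algebra_simps)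
      also have "\<dots> \<le> (1 + N) * norm (?x - ?y)"
        using lip_graphsD(4)[OF p(1), of t ?x ?y] traj_P by (simp add: algebra_simps)
      also have "\<dots> \<le> (1 + N) * (M * norm (\<xi> - \<xi>') * \<alpha> t s)"
        using reduced_lipschitz[OF P0 p(1) trajectory(1)[OF p(1)] trajectory(1)[OF p(1)], of s \<xi> t s \<xi>' s]
          trajectory(2)[OF p(1)] \<xi> N(1) by (intro mult_left_mono) auto
      finally have d: "?d \<le> (1 + N) * M * \<alpha> t s * norm (\<xi> - \<xi>')" by (simp add: mult_ac)
      have "ennreal ?d \<le> ennreal N / \<omega> * ennreal (\<alpha> t s) * ennreal (norm (\<xi> - \<xi>'))"
      \<comment> \<open>For \<open>\<omega> = 0\<close> the right-hand side is infinite unless \<open>\<xi> = \<xi>'\<close>, and then both sides vanish.\<close>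
      proof (cases "w0 = 0")
        case True
        then have "ennreal N / \<omega> = \<infinity>" using N(1) by (simp add: eq ennreal_divide_zero)
        then show ?thesis
          using d by (cases "\<xi> = \<xi>'") (auto simp: ennreal_top_mult ennreal_mult_top)
      next
        case False
        then have "0 < w0" using nn by simp
        have "(1 + N) * M \<le> N / w0"
          using omega_M \<open>0 < w0\<close> by (simp add: pos_le_divide_eq mult_ac)
        then have "(1 + N) * M * \<alpha> t s * norm (\<xi> - \<xi>') \<le> N / w0 * \<alpha> t s * norm (\<xi> - \<xi>')"
          by (intro mult_right_mono) auto
        with d have "ennreal ?d \<le> ennreal (N / w0 * \<alpha> t s * norm (\<xi> - \<xi>'))"
          by (intro ennreal_leI) linarith
        moreover have "ennreal N / \<omega> = ennreal (N / w0)"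
          using \<open>0 < w0\<close> N(1) by (simp add: eq divide_ennreal)
        moreover have "ennreal (N / w0 * \<alpha> t s * norm (\<xi> - \<xi>')) =
            ennreal (N / w0) * ennreal (\<alpha> t s) * ennreal (norm (\<xi> - \<xi>'))"
          using \<open>0 < w0\<close> N(1) by (subst ennreal_mult, simp, simp)+ simp
        ultimately show ?thesis by (simp only:)
      qed
      then show "ennreal (norm (snd (Psi A f (t - s) (s, \<xi> + \<phi> (s, \<xi>))) -
                       snd (Psi A f (t - s) (s, \<xi>' + \<phi> (s, \<xi>')))))
          \<le> ennreal N / \<omega> * ennreal (\<alpha> t s) * ennreal (norm (\<xi> - \<xi>'))"
        using \<xi> by (simp add: Psi \<phi> flow)
    qed
  qed
qed

end
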